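(* (Further cubature formulas related to $\mathcal{P}^{I,-}_k$) Let $n$ be a positive integer. (1) For any integer $N\ge n$ and any polynomial $f\in\mathbb{R}[Y_1,\dots,Y_n]$ of degree at most $2(N-n)+1$, $$\int_{\mathfrak{F}}f(Y)\,\omega^{I,-}(Y)\,dY=\left(\frac{1}{N}\right)^n\sum_{Y\in \mathfrak{F}_N^{\mathrm{I},-}}\mathcal{E}_Y f(Y)\,\mathcal{J}^{I,-}(Y).$$ (2) For any integer $N>n$ and any polynomial $f\in\mathbb{R}[Y_1,\dots,Y_n]$ of degree at most $2(N-n)$, $$\int_{\mathfrak{F}}f(Y)\,\omega^{I,-}(Y)\,dY=\left(\frac{2}{2N-1}\right)^n\sum_{Y\in \mathfrak{F}_N^{\mathrm{V},-}}\mathcal{E}_Y f(Y)\,\mathcal{J}^{I,-}(Y),$$ $$\int_{\mathfrak{F}}f(Y)\,\omega^{I,-}(Y)\,dY=\left(\frac{2}{2N-1}\right)^n\sum_{Y\in \mathfrak{F}_N^{\mathrm{VI},-}}\widetilde{\mathcal{E}}_Y f(Y)\,\mathcal{J}^{I,-}(Y).$$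
   Context: For $\lambda,x\in\mathbb{R}^n$: $\cos^-_\lambda(x)=\sum_{\sigma\in S_n}\mathrm{sgn}(\sigma)\prod_{i=1}^n\cos(\pi\lambda_{\sigma(i)}x_i)$ and $\cos^+_\lambda(x)=\sum_{\sigma\in S_n}\prod_{i=1}^n\cos(\pi\lambda_{\sigma(i)}x_i)$. $F=\{x\in\mathbb{R}^n : 1\ge x_1\ge x_2\ge\dots\ge x_n\ge0\}$. Let $X_j(x)=\cos^+_{(1,\dots,1,0,\dots,0)}(x)$ with $j$ ones and $n-j$ zeros, $j=1,\dots,n$; let $\varphi(x)=(X_1(x),\dots,X_n(x))$ for $x\in F$ and $\mathfrak{F}=\varphi(F)$. The map $\varphi$ is injective on $F$. Let $J(x)=\det\frac{\partial(X_1,\dots,X_n)}{\partial(x_1,\dots,x_n)}$. Then $J(x)^2=p^{I,+}(\varphi(x))$ for a polynomial $p^{I,+}$; put $\mathcal{J}(Y)=\sqrt{p^{I,+}(Y)}$ for $Y\in\mathfrak{F}$ (so $\mathcal{J}(\varphi(x))=|J(x)|$ for $x\in F$). With $\rho_1=(n-1,n-2,\dots,0)$, the polynomial $\mathcal{J}^{I,-}$ is determined by $\mathcal{J}^{I,-}(\varphi(x))=\cos^-_{\rho_1}(x)^2$, and $\omega^{I,-}=\mathcal{J}^{I,-}/\mathcal{J}$. For fixed $N$: $c_r=\frac12$ if $r=0$ or $r=N$, and $c_r=1$ otherwise; $D_M^-=\{r\in\mathbb{Z}^n : M-1\ge r_1>\dots>r_n\ge0\}$. Grids: $F_N^{\mathrm{I},-}=\left\{\left(\frac{r_1}{N},\dots,\frac{r_n}{N}\right):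 r\in D_{N+1}^-\right\}$, $F_N^{\mathrm{V},-}=\left\{\left(\frac{2r_1}{2N-1},\dots,\frac{2r_n}{2N-1}\right): r\in D_{N}^-\right\}$, $F_N^{\mathrm{VI},-}=\left\{\left(\frac{2(r_1+\frac12)}{2N-1},\dots,\frac{2(r_n+\frac12)}{2N-1}\right): r\in D_{N}^-\right\}$, and $\mathfrak{F}_N^{t,-}=\varphi(F_N^{t,-})$. For $Y=\varphi(s)$ with $s$ the grid point labeled by $r$: $\mathcal{E}_Y=c_{r_1}\cdots c_{r_n}$ (grids I and V); $\widetilde{\mathcal{E}}_Y=c_{r_1+1}\cdots c_{r_n+1}$ (grid VI). *)

theory Defs
  imports "HOL-Analysis.Analysis" "HOL-Library.Poly_Mapping"
begin

text \<open>
  The dimension \<open>n\<close> is \<open>CARD('n)\<close>, and the linearly ordered index type \<open>'n\<close> plays the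
  role of \<open>{1, ..., n}\<close>: the number of indices \<open>k \<le> i\<close> is the position of \<open>i\<close>.
\<close>

definition cos_minus :: "real^'n \<Rightarrow> real^'n \<Rightarrow> real" where
  "cos_minus l x =
     (\<Sum>\<sigma> | \<sigma> permutes (UNIV :: 'n set). of_int (sign \<sigma>) * (\<Prod>i\<in>UNIV. cos (pi * l $ \<sigma> i * x $ i)))"

definition cos_plus :: "real^'n \<Rightarrow> real^'n \<Rightarrow> real" where
  "cos_plus l x =
     (\<Sum>\<sigma> | \<sigma> permutes (UNIV :: 'n set). \<Prod>i\<in>UNIV. cos (pi * l $ \<sigma> i * x $ i))"

definition Fdom :: "(real^'n::{finite,wellorder}) set" where
  "Fdom = {x. (\<forall>i. 0 \<le> x $ i \<and> x $ i \<le> 1) \<and> (\<forall>i j. i \<le> j \<longrightarrow> x $ j \<le> x $ i)}"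

definition Xvar :: "'n::{finite,wellorder} \<Rightarrow> real^'n::_ \<Rightarrow> real" where
  "Xvar j x = cos_plus (\<chi> i. if i \<le> j then 1 else 0) x"

text \<open>The map is given by its formula on the whole space, so that it has a Jacobian at
  boundary points of \<open>Fdom\<close> as well.\<close>

definition phi :: "real^'n::{finite,wellorder} \<Rightarrow> real^'n::_" where
  "phi x = (\<chi> j. Xvar j x)"

definition FF :: "(real^'n::{finite,wellorder}) set" where
  "FF = phi ` Fdom"

definition Jdet :: "real^'n::{finite,wellorder} \<Rightarrow> real" where
  "Jdet x = det (jacobian phi (at x))"

text \<open>Real polynomials in the variables \<open>Y $ i\<close>, as finitely supported maps from exponent
  vectors to coefficients.\<close>

type_synonym 'n rpoly = "('n \<Rightarrow>\<^sub>0 nat) \<Rightarrow>\<^sub>0 real"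

definition peval :: "'n::finite rpoly \<Rightarrow> real^'n \<Rightarrow> real" where
  "peval p Y = (\<Sum>m\<in>Poly_Mapping.keys p.
      Poly_Mapping.lookup p m * (\<Prod>i\<in>UNIV. (Y $ i) ^ Poly_Mapping.lookup m i))"

definition total_degree :: "'n::finite rpoly \<Rightarrow> nat" where
  "total_degree p =
     Max (insert 0 ((\<lambda>m. \<Sum>i\<in>UNIV. Poly_Mapping.lookup m i) ` Poly_Mapping.keys p))"

text \<open>The polynomials below are determined by the equations that select them, because
  \<open>FF\<close> has nonempty interior.\<close>

definition p_I_plus :: "'n::{finite,wellorder} rpoly" where
  "p_I_plus = (SOME p. \<forall>x\<in>Fdom. peval p (phi x) = (Jdet x)\<^sup>2)"

definition JJ :: "real^'n::{finite,wellorder} \<Rightarrow> real" where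
  "JJ Y = sqrt (peval p_I_plus Y)"

definition rho1 :: "real^'n::{finite,wellorder}" where
  "rho1 = (\<chi> i. real (card {k. i < k}))"

definition J_I_minus :: "'n::{finite,wellorder} rpoly" where
  "J_I_minus = (SOME p. \<forall>x\<in>Fdom. peval p (phi x) = (cos_minus rho1 x)\<^sup>2)"

text \<open>At points where \<open>JJ\<close> vanishes (images of boundary points of \<open>Fdom\<close>, a null set)
  the quotient takes the value 0.\<close>

definition omega_I_minus :: "real^'n::{finite,wellorder} \<Rightarrow> real" where
  "omega_I_minus Y = peval J_I_minus Y / JJ Y"

definition cwt :: "nat \<Rightarrow> int \<Rightarrow> real" where
  "cwt N r = (if r = 0 \<or> r = int N then 1 / 2 else 1)"

definition D_minus :: "nat \<Rightarrow> (int^'n::{finite,wellorder}) set" where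
  "D_minus M = {r. (\<forall>i. 0 \<le> r $ i \<and> r $ i \<le> int M - 1) \<and> (\<forall>i j. i < j \<longrightarrow> r $ j < r $ i)}"

definition pt_I :: "nat \<Rightarrow> int^'n \<Rightarrow> real^'n" where
  "pt_I N r = (\<chi> i. of_int (r $ i) / real N)"

definition pt_V :: "nat \<Rightarrow> int^'n \<Rightarrow> real^'n" where
  "pt_V N r = (\<chi> i. 2 * of_int (r $ i) / (2 * real N - 1))"

definition pt_VI :: "nat \<Rightarrow> int^'n \<Rightarrow> real^'n" where
  "pt_VI N r = (\<chi> i. 2 * (of_int (r $ i) + 1 / 2) / (2 * real N - 1))"

definition F_I_minus :: "nat \<Rightarrow> (real^'n::{finite,wellorder}) set" where
  "F_I_minus N = pt_I N ` D_minus (N + 1)"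

definition F_V_minus :: "nat \<Rightarrow> (real^'n::{finite,wellorder}) set" where
  "F_V_minus N = pt_V N ` D_minus N"

definition F_VI_minus :: "nat \<Rightarrow> (real^'n::{finite,wellorder}) set" where
  "F_VI_minus N = pt_VI N ` D_minus N"

definition FF_I_minus :: "nat \<Rightarrow> (real^'n::{finite,wellorder}) set" where
  "FF_I_minus N = phi ` F_I_minus N"

definition FF_V_minus :: "nat \<Rightarrow> (real^'n::{finite,wellorder}) set" where
  "FF_V_minus N = phi ` F_V_minus N"

definition FF_VI_minus :: "nat \<Rightarrow> (real^'n::{finite,wellorder}) set" where
  "FF_VI_minus N = phi ` F_VI_minus N"

text \<open>The label \<open>r\<close> of a node \<open>Y\<close> is unique because \<open>phi\<close> is injective on \<open>Fdom\<close>,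
  which contains the grid points.\<close>

definition node_label ::
  "(int^'n::_) set \<Rightarrow> (int^'n::_ \<Rightarrow> real^'n::_) \<Rightarrow> real^'n::{finite,wellorder} \<Rightarrow> int^'n::_" where
  "node_label D s Y = (THE r. r \<in> D \<and> phi (s r) = Y)"

definition E_I :: "nat \<Rightarrow> real^'n::{finite,wellorder} \<Rightarrow> real" where
  "E_I N Y = (\<Prod>i\<in>UNIV. cwt N (node_label (D_minus (N + 1)) (pt_I N) Y $ i))"

definition E_V :: "nat \<Rightarrow> real^'n::{finite,wellorder} \<Rightarrow> real" where
  "E_V N Y = (\<Prod>i\<in>UNIV. cwt N (node_label (D_minus N) (pt_V N) Y $ i))"

definition E_VI :: "nat \<Rightarrow> real^'n::{finite,wellorder} \<Rightarrow> real" where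
  "E_VI N Y = (\<Prod>i\<in>UNIV. cwt N (node_label (D_minus N) (pt_VI N) Y $ i + 1))"

end

theory Submission
  imports Defs
begin

text \<open>
Write \<open>y i = cos (pi * x $ i)\<close>. Up to positive constants the coordinates of \<open>phi x\<close> are the
  elementary symmetric functions \<open>e 1, ..., e n\<close> of the numbers \<open>y i\<close>; this makes \<open>phi\<close> injective
  on the cone \<open>Fdom\<close>, because symmetric functions determine the multiset of the \<open>y i\<close> and on
  \<open>Fdom\<close> the \<open>y i\<close> are sorted (\<open>inj_on_phi\<close>). Substituting \<open>Y = phi x\<close> therefore turns the
  weighted integral over \<open>FF\<close> into the integral over \<open>Fdom\<close> of
  \<open>h x = peval f (phi x) * (cos_minus rho1 x)\<^sup>2\<close>: the Jacobian cancels against the denominator \<open>JJ\<close>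
  wherever it does not vanish, and it vanishes only on a null set (\<open>has_integral_omega\<close>).

  The function \<open>h\<close> is symmetric in the coordinates, so its integral over \<open>Fdom\<close> is \<open>1 / n!\<close> times
  its integral over the unit cube (\<open>integral_symmetric\<close>). In each single coordinate \<open>h\<close> is a cosine
  polynomial of degree at most \<open>total_degree f + 2 * (n - 1)\<close>, because every coordinate of \<open>phi\<close> has
  degree one and \<open>cos_minus rho1\<close> has degree \<open>n - 1\<close>. On the cube the integral is therefore computed
  exactly by the \<open>n\<close>-fold product of any one-dimensional quadrature rule that is exact to that
  degree (\<open>quadrature_trig_polys\<close>). The product rule sums over all of the node grid; the antisymmetric
  factor \<open>cos_minus rho1\<close> kills the nodes with a repeated coordinate, and the others fall into \<open>n!\<close>
  permuted copies of the strictly decreasing ones (\<open>sum_symmetric\<close>). The two factors \<open>n!\<close> cancel,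
  which leaves the stated sum (\<open>cubature_strict_cone\<close>). The three formulas are the cases of the nodes
  \<open>r / N\<close>, exact up to degree \<open>2 * N - 1\<close>, and of \<open>2 * r / (2 * N - 1)\<close> and \<open>(2 * r + 1) / (2 * N - 1)\<close>,
  exact up to degree \<open>2 * N - 2\<close>.

  The polynomials \<open>p_I_plus\<close> and \<open>J_I_minus\<close> are chosen by a property, so one also has to show
  that polynomials with this property exist. Both squares are Gram determinants \<open>det (M ** transpose M)\<close>
  whose entries are sums over the coordinates \<open>i\<close> of polynomials in \<open>y i\<close> with coefficients that are
  polynomials in \<open>phi x\<close>; these sums are power sums with such coefficients, hence by Newton's identities
  polynomials in \<open>phi x\<close> (\<open>coord_X_polys_sum_coords\<close>).
\<close>

section \<open>Finite sums of functions\<close>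

text \<open>Each function class below (polynomial functions, cosine polynomials in one and several variables) is
  the additive closure of a set of generators whose pairwise products lie in such a closure again. So
  closure under products has to be checked on generators only (\<open>fin_sums_mult\<close>), and linear
  statements follow by induction.\<close>

inductive_set fin_sums :: "('a \<Rightarrow> real) set \<Rightarrow> ('a \<Rightarrow> real) set" for G where
  zero: "(\<lambda>x. 0) \<in> fin_sums G"
| step: "g \<in> G \<Longrightarrow> f \<in> fin_sums G \<Longrightarrow> (\<lambda>x. g x + f x) \<in> fin_sums G"

lemma fin_sums_base: "g \<in> G \<Longrightarrow> g \<in> fin_sums G"
  using fin_sums.step[OF _ fin_sums.zero] by fastforce

lemma fin_sums_add:
  assumes "f \<in> fin_sums G" "h \<in> fin_sums G"
  shows "(\<lambda>x. f x + h x) \<in> fin_sums G"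
  using assms
proof induction
  case (step g f)
  from fin_sums.step[OF step(1) step(3)[OF step(4)]] show ?case by (simp add: add.assoc)
qed simp

lemma fin_sums_sum:
  assumes "\<And>i. i \<in> I \<Longrightarrow> f i \<in> fin_sums G"
  shows "(\<lambda>x. \<Sum>i\<in>I. f i x) \<in> fin_sums G"
  using assms
  by (induction I rule: infinite_finite_induct) (simp_all add: fin_sums.zero fin_sums_add)

lemma fin_sums_subset:
  assumes "f \<in> fin_sums G" "G \<subseteq> fin_sums H"
  shows "f \<in> fin_sums H"
  using assms
proof induction
  case (step g f)
  then show ?case using fin_sums_add[of g H f] by auto
qed (simp add: fin_sums.zero)

lemma fin_sums_mono: "G \<subseteq> H \<Longrightarrow> fin_sums G \<subseteq> fin_sums H"
  using fin_sums_subset fin_sums_base by blast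

lemma fin_sums_mult:
  assumes f: "f \<in> fin_sums G" and h: "h \<in> fin_sums H"
    and GH: "\<And>u v. u \<in> G \<Longrightarrow> v \<in> H \<Longrightarrow> (\<lambda>x. u x * v x) \<in> fin_sums K"
  shows "(\<lambda>x. f x * h x) \<in> fin_sums K"
  using f
proof induction
  case zero
  show ?case by (simp add: fin_sums.zero)
next
  case (step g f)
  have "(\<lambda>x. g x * h x) \<in> fin_sums K"
    using h
  proof induction
    case zero
    show ?case by (simp add: fin_sums.zero)
  next
    case (step u w)
    show ?case
      using fin_sums_add[OF GH[OF \<open>g \<in> G\<close> step(1)] step(3)] by (simp add: distrib_left)
  qed
  from fin_sums_add[OF this step(3)] show ?case by (simp add: distrib_right)
qed

section \<open>Polynomial functions of the map phi\<close>

definition monomial_funs :: "(real^'n::finite \<Rightarrow> real) set" where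
  "monomial_funs = {(\<lambda>Y. c * (\<Prod>i\<in>UNIV. (Y $ i) ^ m i)) | c m. True}"

lemma peval_superset:
  assumes "finite A" "Poly_Mapping.keys p \<subseteq> A"
  shows "peval p Y = (\<Sum>m\<in>A. Poly_Mapping.lookup p m * (\<Prod>i\<in>UNIV. (Y $ i) ^ Poly_Mapping.lookup m i))"
  unfolding peval_def
  by (rule sum.mono_neutral_left) (use assms in \<open>auto simp: in_keys_iff\<close>)

lemma peval_add: "peval (p + q) Y = peval p Y + peval q Y"
proof -
  let ?A = "Poly_Mapping.keys p \<union> Poly_Mapping.keys q"
  have "peval (p + q) Y = (\<Sum>m\<in>?A. Poly_Mapping.lookup (p + q) m * (\<Prod>i\<in>UNIV. (Y $ i) ^ Poly_Mapping.lookup m i))"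
    by (rule peval_superset) (use Poly_Mapping.keys_add[of p q] in auto)
  also have "\<dots> = peval p Y + peval q Y"
    by (simp add: peval_superset[of ?A p] peval_superset[of ?A q] lookup_add distrib_right sum.distrib)
  finally show ?thesis .
qed

lemma peval_single:
  "peval (Poly_Mapping.single m c) Y = c * (\<Prod>i\<in>UNIV. (Y $ i) ^ Poly_Mapping.lookup m i)"
  by (subst peval_superset[of "{m}"]) auto

text \<open>Working with polynomial functions instead of formal polynomials avoids the multiplication of
  finitely supported maps: a product of two monomial functions is again a monomial function, so only
  sums of formal polynomials have to be evaluated.\<close>

lemma polynomial_function_peval:
  assumes "f \<in> fin_sums monomial_funs"
  shows "\<exists>p. \<forall>Y. peval p Y = f Y"
  using assms
proof induction
  case zero
  show ?case by (intro exI[of _ 0]) (simp add: peval_def)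
next
  case (step g f)
  then obtain c m p where g: "g = (\<lambda>Y. c * (\<Prod>i\<in>UNIV. (Y $ i) ^ m i))" and p: "\<forall>Y. peval p Y = f Y"
    by (auto simp: monomial_funs_def)
  have "peval (Poly_Mapping.single (Abs_poly_mapping m) c + p) Y = g Y + f Y" for Y
    by (simp add: peval_add peval_single p g Abs_poly_mapping_inverse)
  then show ?case by blast
qed

definition X_polys :: "(real^'n::{finite,wellorder} \<Rightarrow> real) set" where
  "X_polys = {g. \<exists>p. \<forall>x. g x = p (phi x) \<and> p \<in> fin_sums monomial_funs}"

lemma X_polys_peval: "g \<in> X_polys \<Longrightarrow> \<exists>p. \<forall>x. peval p (phi x) = g x"
proof -
  assume "g \<in> X_polys"
  then obtain p where p: "\<forall>x. g x = p (phi x)" "p \<in> fin_sums monomial_funs"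
    by (auto simp: X_polys_def)
  from polynomial_function_peval[OF p(2)] p(1) show ?thesis by metis
qed

lemma X_polys_const: "(\<lambda>x. c) \<in> X_polys"
proof -
  have "(\<lambda>Y. c) \<in> fin_sums monomial_funs"
    by (rule fin_sums_base) (auto simp: monomial_funs_def intro!: exI[of _ c] exI[of _ "\<lambda>_. 0"])
  then show ?thesis unfolding X_polys_def by (auto intro!: exI[of _ "\<lambda>_. c"])
qed

lemma X_polys_coord:
  fixes i :: "'n::{finite,wellorder}"
  shows "(\<lambda>x. phi x $ i) \<in> X_polys"
proof -
  have *: "(\<Prod>j\<in>UNIV. (Y $ j) ^ (if j = i then 1 else 0)) = Y $ i" for Y :: "real^'n::_"
    by (simp add: if_distrib[of "\<lambda>k. _ ^ k"] prod.If_cases cong: if_cong)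
  have "(\<lambda>Y :: real^'n::_. Y $ i) \<in> fin_sums monomial_funs"
    by (rule fin_sums_base)
       (auto simp: monomial_funs_def * intro!: exI[of _ 1] exI[of _ "\<lambda>j. if j = i then 1 else 0"])
  then show ?thesis unfolding X_polys_def by (auto intro!: exI[of _ "\<lambda>Y. Y $ i"])
qed

lemma X_polys_add:
  assumes "f \<in> X_polys" "g \<in> X_polys" shows "(\<lambda>x. f x + g x) \<in> X_polys"
proof -
  from assms obtain p q where "\<forall>x. f x = p (phi x) \<and> p \<in> fin_sums monomial_funs"
    "\<forall>x. g x = q (phi x) \<and> q \<in> fin_sums monomial_funs" by (auto simp: X_polys_def)
  then show ?thesis unfolding X_polys_def
    by (auto intro!: exI[of _ "\<lambda>Y. p Y + q Y"] fin_sums_add)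
qed

lemma monomial_funs_mult:
  fixes u v :: "real^'n::finite \<Rightarrow> real"
  assumes "u \<in> monomial_funs" "v \<in> monomial_funs"
  shows "(\<lambda>Y. u Y * v Y) \<in> fin_sums monomial_funs"
proof -
  from assms obtain c m d k where "u = (\<lambda>Y. c * (\<Prod>i\<in>UNIV. (Y $ i) ^ m i))"
    "v = (\<lambda>Y. d * (\<Prod>i\<in>UNIV. (Y $ i) ^ k i))" by (auto simp: monomial_funs_def)
  then have "(\<lambda>Y. u Y * v Y) = (\<lambda>Y. (c * d) * (\<Prod>i\<in>UNIV. (Y $ i) ^ (m i + k i)))"
    by (simp add: power_add prod.distrib mult_ac)
  then show ?thesis
    by (intro fin_sums_base) (auto simp: monomial_funs_def)
qed

lemma X_polys_mult:
  assumes "f \<in> X_polys" "g \<in> X_polys" shows "(\<lambda>x. f x * g x) \<in> X_polys"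
proof -
  from assms obtain p q where p: "\<forall>x. f x = p (phi x)" "p \<in> fin_sums monomial_funs"
    and q: "\<forall>x. g x = q (phi x)" "q \<in> fin_sums monomial_funs" by (auto simp: X_polys_def)
  have "(\<lambda>Y. p Y * q Y) \<in> fin_sums monomial_funs"
    by (rule fin_sums_mult[OF p(2) q(2) monomial_funs_mult])
  then show ?thesis unfolding X_polys_def using p(1) q(1)
    by (auto intro!: exI[of _ "\<lambda>Y. p Y * q Y"])
qed

lemma X_polys_sum:
  assumes "\<And>i. i \<in> I \<Longrightarrow> f i \<in> X_polys" shows "(\<lambda>x. \<Sum>i\<in>I. f i x) \<in> X_polys"
  using assms by (induction I rule: infinite_finite_induct) (simp_all add: X_polys_const X_polys_add)

lemma X_polys_prod:
  assumes "\<And>i. i \<in> I \<Longrightarrow> f i \<in> X_polys" shows "(\<lambda>x. \<Prod>i\<in>I. f i x) \<in> X_polys"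
  using assms by (induction I rule: infinite_finite_induct) (simp_all add: X_polys_const X_polys_mult)

section \<open>Elementary symmetric functions\<close>

definition esym :: "'a set \<Rightarrow> nat \<Rightarrow> ('a \<Rightarrow> real) \<Rightarrow> real" where
  "esym A k y = (\<Sum>S | S \<subseteq> A \<and> card S = k. \<Prod>i\<in>S. y i)"

lemma esym_0: "finite A \<Longrightarrow> esym A 0 y = 1"
proof -
  assume "finite A"
  then have "{S. S \<subseteq> A \<and> card S = 0} = {{}}" by (auto dest: finite_subset)
  then show ?thesis by (simp add: esym_def)
qed

lemma esym_eq_0: "finite A \<Longrightarrow> card A < k \<Longrightarrow> esym A k y = 0"
proof -
  assume "finite A" "card A < k"
  then have "{S. S \<subseteq> A \<and> card S = k} = {}" by (auto dest: card_mono)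
  then show ?thesis unfolding esym_def by (metis sum.empty)
qed

lemma esym_remove:
  assumes "finite A" "a \<in> A"
  shows "esym A (Suc k) y = esym (A - {a}) (Suc k) y + y a * esym (A - {a}) k y"
proof -
  let ?N = "{S. S \<subseteq> A - {a} \<and> card S = Suc k}" and ?M = "{S. S \<subseteq> A - {a} \<and> card S = k}"
  have fin: "finite S" if "S \<subseteq> A - {a}" for S using that assms finite_subset by blast
  have split: "{S. S \<subseteq> A \<and> card S = Suc k} = ?N \<union> insert a ` ?M"
  proof (intro equalityI subsetI)
    fix S assume S: "S \<in> {S. S \<subseteq> A \<and> card S = Suc k}"
    show "S \<in> ?N \<union> insert a ` ?M"
    proof (cases "a \<in> S")
      case True
      then have "S = insert a (S - {a})" by auto
      moreover have "S - {a} \<in> ?M" using S True by auto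
      ultimately show ?thesis by blast
    qed (use S in auto)
  next
    fix S assume "S \<in> ?N \<union> insert a ` ?M"
    then show "S \<in> {S. S \<subseteq> A \<and> card S = Suc k}"
    proof
      assume "S \<in> insert a ` ?M"
      then obtain T where T: "S = insert a T" "T \<subseteq> A - {a}" "card T = k" by auto
      then have "card S = Suc k" using fin[of T] by (subst T(1), subst card_insert_disjoint) auto
      then show ?thesis using T assms by auto
    qed auto
  qed
  have inj: "inj_on (insert a) ?M" by (auto intro!: inj_onI)
  have "esym A (Suc k) y = (\<Sum>S\<in>?N. \<Prod>i\<in>S. y i) + (\<Sum>S\<in>insert a ` ?M. \<Prod>i\<in>S. y i)"
    unfolding esym_def split
    by (rule sum.union_disjoint) (use assms in \<open>auto intro: finite_subset[of _ "Pow A"]\<close>)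
  also have "(\<Sum>S\<in>insert a ` ?M. \<Prod>i\<in>S. y i) = (\<Sum>S\<in>?M. y a * (\<Prod>i\<in>S. y i))"
    unfolding sum.reindex[OF inj] comp_def
    by (intro sum.cong refl) (auto simp: fin intro!: prod.insert)
  finally show ?thesis by (simp add: esym_def sum_distrib_left)
qed

text \<open>Unfolding the recursion \<open>esym A (Suc k) = esym (A - {a}) (Suc k) + y a * esym (A - {a}) k\<close>
  for the terms without \<open>a\<close> gives an expression in the full symmetric functions and powers of \<open>y a\<close>.\<close>

lemma esym_without:
  assumes "finite A" "a \<in> A"
  shows "esym (A - {a}) k y = (\<Sum>l\<le>k. (- y a) ^ l * esym A (k - l) y)"
proof (induction k)
  case (Suc k)
  have "(\<Sum>l\<le>Suc k. (- y a) ^ l * esym A (Suc k - l) y)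
      = esym A (Suc k) y + (\<Sum>l\<le>k. - y a * ((- y a) ^ l * esym A (k - l) y))"
    by (subst sum.atMost_Suc_shift) (simp add: mult.assoc)
  also have "\<dots> = esym A (Suc k) y - y a * esym (A - {a}) k y"
    unfolding Suc.IH sum_distrib_left[symmetric] by simp
  finally show ?case using esym_remove[OF assms, of k y] by simp
qed (use assms in \<open>simp add: esym_0\<close>)

text \<open>A subset of size \<open>k\<close> avoids exactly \<open>card A - k\<close> points of \<open>A\<close>. The factor is a difference of
  reals so that the equation also holds, with both sides zero, for \<open>k > card A\<close>.\<close>

lemma sum_esym_without:
  assumes "finite A"
  shows "(\<Sum>a\<in>A. esym (A - {a}) k y) = (real (card A) - real k) * esym A k y"
proof -
  let ?T = "{S. S \<subseteq> A \<and> card S = k}"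
  have fin: "finite ?T" using assms by (auto intro: finite_subset[of _ "Pow A"])
  have "(\<Sum>a\<in>A. esym (A - {a}) k y) = (\<Sum>a\<in>A. \<Sum>S | S \<in> ?T \<and> a \<notin> S. \<Prod>i\<in>S. y i)"
    unfolding esym_def by (intro sum.cong refl arg_cong2[of _ _ _ _ sum]) auto
  also have "\<dots> = (\<Sum>S\<in>?T. \<Sum>a | a \<in> A \<and> a \<notin> S. \<Prod>i\<in>S. y i)"
    using sum.swap_restrict[OF assms fin, of "\<lambda>a S. \<Prod>i\<in>S. y i" "\<lambda>a S. a \<notin> S"] by simp
  also have "\<dots> = (\<Sum>S\<in>?T. (real (card A) - real k) * (\<Prod>i\<in>S. y i))"
  proof (intro sum.cong refl)
    fix S assume S: "S \<in> ?T"
    have "{a. a \<in> A \<and> a \<notin> S} = A - S" by auto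
    moreover have "card (A - S) = card A - k" "k \<le> card A"
      using S assms by (auto simp: card_Diff_subset finite_subset card_mono)
    ultimately show "(\<Sum>a | a \<in> A \<and> a \<notin> S. \<Prod>i\<in>S. y i) = (real (card A) - real k) * (\<Prod>i\<in>S. y i)"
      by (simp add: of_nat_diff)
  qed
  finally show ?thesis by (simp add: esym_def sum_distrib_left)
qed

text \<open>Newton's identity: sum \<open>esym_without\<close> over \<open>a\<close> and compare with \<open>sum_esym_without\<close>. It is
  solved for the highest power sum, with no case distinction between \<open>k \<le> card A\<close> and \<open>k > card A\<close>.\<close>

lemma newton_identity:
  assumes "finite A"
  shows "(- 1) ^ k * (\<Sum>a\<in>A. y a ^ k) =
    (real (card A) - real k) * esym A k y - (\<Sum>l<k. (- 1) ^ l * (\<Sum>a\<in>A. y a ^ l) * esym A (k - l) y)"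
proof -
  have "(real (card A) - real k) * esym A k y = (\<Sum>a\<in>A. \<Sum>l\<le>k. (- y a) ^ l * esym A (k - l) y)"
    using sum_esym_without[OF assms, of k y] esym_without[OF assms, of _ k y] by simp
  also have "\<dots> = (\<Sum>l\<le>k. \<Sum>a\<in>A. (- y a) ^ l * esym A (k - l) y)"
    by (rule sum.swap)
  also have "\<dots> = (\<Sum>l\<le>k. (- 1) ^ l * (\<Sum>a\<in>A. y a ^ l) * esym A (k - l) y)"
    by (simp add: sum_distrib_left sum_distrib_right power_minus[of "y _"] mult_ac)
  also have "\<dots> = (\<Sum>l<k. (- 1) ^ l * (\<Sum>a\<in>A. y a ^ l) * esym A (k - l) y) + (- 1) ^ k * (\<Sum>a\<in>A. y a ^ k)"
    using assms by (simp add: lessThan_Suc_atMost[symmetric] esym_0)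
  finally show ?thesis by simp
qed

lemma prod_add_esym:
  assumes "finite A"
  shows "(\<Prod>i\<in>A. y i + t) = (\<Sum>k\<le>card A. esym A k y * t ^ (card A - k))"
proof -
  have "(\<Prod>i\<in>A. y i + t) = (\<Sum>S\<in>Pow A. (\<Prod>i\<in>S. y i) * t ^ card (A - S))"
    using prod_add[OF assms, of y "\<lambda>_. t"] by simp
  also have "\<dots> = (\<Sum>k\<in>card ` Pow A. \<Sum>S | S \<in> Pow A \<and> card S = k. (\<Prod>i\<in>S. y i) * t ^ card (A - S))"
    using assms by (intro sum.image_gen) simp
  also have "\<dots> = (\<Sum>k\<in>{..card A}. \<Sum>S | S \<in> Pow A \<and> card S = k. (\<Prod>i\<in>S. y i) * t ^ card (A - S))"
  proof (rule sum.mono_neutral_left)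
    show "card ` Pow A \<subseteq> {..card A}" using assms by (auto simp: card_mono)
  qed (auto intro!: sum.neutral)
  also have "\<dots> = (\<Sum>k\<le>card A. esym A k y * t ^ (card A - k))"
    unfolding esym_def sum_distrib_right
    by (intro sum.cong refl) (use assms in \<open>auto simp: card_Diff_subset finite_subset\<close>)
  finally show ?thesis .
qed

lemma exists_permutes_image:
  fixes S T :: "'n::finite set"
  assumes "card S = card T"
  shows "\<exists>\<tau>. \<tau> permutes UNIV \<and> \<tau> ` S = T"
proof -
  obtain f where f: "bij_betw f S T" using assms by (meson finite finite_same_card_bij)
  have "card (- S) = card (- T)" using assms by (simp add: card_Diff_subset Compl_eq_Diff_UNIV)
  then obtain g where g: "bij_betw g (- S) (- T)" by (meson finite finite_same_card_bij)
  define h where "h = (\<lambda>i. if i \<in> S then f i else g i)"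
  have "bij_betw h (S \<union> - S) (T \<union> - T)"
    unfolding h_def by (rule bij_betw_disjoint_Un[OF f g]) auto
  then have "h permutes UNIV" by (intro bij_imp_permutes) auto
  moreover have "h ` S = T" using f by (auto simp: h_def bij_betw_def)
  ultimately show ?thesis by blast
qed

definition pos :: "'n::{finite,wellorder} \<Rightarrow> nat" where
  "pos j = card {k. k \<le> j}"

text \<open>The number \<open>p! * (n - p)!\<close> for \<open>p = pos j\<close>, kept as a count because the arguments below
  use only that it is positive.\<close>

definition esym_coeff :: "'n::{finite,wellorder} \<Rightarrow> real" where
  "esym_coeff j = real (card {\<sigma> :: 'n \<Rightarrow> 'n. \<sigma> permutes UNIV \<and> {i. \<sigma> i \<le> j} = {k. k \<le> j}})"

lemma esym_coeff_pos: "esym_coeff j > 0"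
proof -
  have "id \<in> {\<sigma> :: 'a \<Rightarrow> 'a. \<sigma> permutes UNIV \<and> {i. \<sigma> i \<le> j} = {k. k \<le> j}}"
    by (simp add: permutes_id)
  then have "card {\<sigma> :: 'a \<Rightarrow> 'a. \<sigma> permutes UNIV \<and> {i. \<sigma> i \<le> j} = {k. k \<le> j}} > 0"
    by (subst card_gt_0_iff) (blast intro: finite_subset[OF _ finite_permutations[OF finite, of UNIV]])
  then show ?thesis by (simp add: esym_coeff_def)
qed

text \<open>A permutation \<open>\<sigma>\<close> contributes the product of the \<open>y i\<close> over \<open>{i. \<sigma> i \<le> j}\<close>. Every
  set of \<open>pos j\<close> indices arises in this way from equally many permutations, since composing with a
  permutation that moves one such set to another is a bijection.\<close>

lemma Xvar_esym:
  fixes x :: "real^'n::{finite,wellorder}"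
  shows "Xvar j x = esym_coeff j * esym UNIV (pos j) (\<lambda>i. cos (pi * x $ i))"
proof -
  define y where "y = (\<lambda>i. cos (pi * x $ i))"
  let ?P = "{\<sigma> :: 'n \<Rightarrow> 'n. \<sigma> permutes UNIV}" and ?L = "{k. k \<le> j}"
  let ?T = "{S :: 'n set. S \<subseteq> UNIV \<and> card S = pos j}"
  have finP: "finite ?P" by (simp add: finite_permutations)
  have pre: "{i. \<sigma> i \<le> j} \<in> ?T" if "\<sigma> \<in> ?P" for \<sigma>
  proof -
    have "\<sigma> ` {i. \<sigma> i \<le> j} = ?L" using that permutes_surj[of \<sigma>] by (auto simp: image_iff) (metis surj_def)
    moreover have "inj_on \<sigma> {i. \<sigma> i \<le> j}" using that by (auto intro: inj_on_subset permutes_inj)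
    ultimately show ?thesis by (auto simp: pos_def dest: card_image)
  qed
  have count: "real (card {\<sigma> \<in> ?P. {i. \<sigma> i \<le> j} = S}) = esym_coeff j" if S: "S \<in> ?T" for S
  proof -
    obtain \<tau> where \<tau>: "\<tau> permutes UNIV" "\<tau> ` S = ?L"
      using exists_permutes_image[of S ?L] S by (auto simp: pos_def)
    have mem: "\<tau> i \<le> j \<longleftrightarrow> i \<in> S" for i
      using inj_image_mem_iff[OF permutes_inj[OF \<tau>(1)], of i S] \<tau>(2) by simp
    have "bij_betw (\<lambda>\<sigma>. \<sigma> \<circ> \<tau>) {\<sigma>. \<sigma> permutes UNIV \<and> {i. \<sigma> i \<le> j} = ?L}
        {\<sigma> \<in> ?P. {i. \<sigma> i \<le> j} = S}"
    proof (rule bij_betw_byWitness[where f' = "\<lambda>\<sigma>. \<sigma> \<circ> inv \<tau>"])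
      show "(\<lambda>\<sigma>. \<sigma> \<circ> \<tau>) ` {\<sigma>. \<sigma> permutes UNIV \<and> {i. \<sigma> i \<le> j} = ?L} \<subseteq> {\<sigma> \<in> ?P. {i. \<sigma> i \<le> j} = S}"
        using \<tau>(1) mem by (auto simp: permutes_compose set_eq_iff)
      have inv_mem: "inv \<tau> i \<in> S \<longleftrightarrow> i \<le> j" for i
        using mem[of "inv \<tau> i"] \<tau>(1) by (simp add: permutes_inverses)
      have "{i. (\<sigma> \<circ> inv \<tau>) i \<le> j} = ?L" if "{i. \<sigma> i \<le> j} = S" for \<sigma>
      proof -
        have "\<sigma> i \<le> j \<longleftrightarrow> i \<in> S" for i using that by blast
        then show ?thesis by (simp add: inv_mem)
      qed
      then show "(\<lambda>\<sigma>. \<sigma> \<circ> inv \<tau>) ` {\<sigma> \<in> ?P. {i. \<sigma> i \<le> j} = S} \<subseteq> {\<sigma>. \<sigma> permutes UNIV \<and> {i. \<sigma> i \<le> j} = ?L}"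
        using permutes_compose[OF permutes_inv[OF \<tau>(1)]] by blast
    qed (use \<tau>(1) in \<open>auto simp: comp_assoc permutes_inv_o\<close>)
    then show ?thesis unfolding esym_coeff_def using bij_betw_same_card by fastforce
  qed
  have "Xvar j x = (\<Sum>\<sigma>\<in>?P. \<Prod>i\<in>{i. \<sigma> i \<le> j}. y i)"
    unfolding Xvar_def cos_plus_def y_def
    by (intro sum.cong refl prod.mono_neutral_cong_right) auto
  also have "\<dots> = (\<Sum>S\<in>?T. \<Sum>\<sigma> | \<sigma> \<in> ?P \<and> {i. \<sigma> i \<le> j} = S. \<Prod>i\<in>{i. \<sigma> i \<le> j}. y i)"
    by (rule sum.group[symmetric]) (use finP pre in auto)
  also have "\<dots> = (\<Sum>S\<in>?T. esym_coeff j * (\<Prod>i\<in>S. y i))"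
  proof (intro sum.cong refl)
    fix S assume "S \<in> ?T"
    have "(\<Sum>\<sigma> | \<sigma> \<in> ?P \<and> {i. \<sigma> i \<le> j} = S. \<Prod>i\<in>{i. \<sigma> i \<le> j}. y i)
        = (\<Sum>\<sigma> | \<sigma> \<in> ?P \<and> {i. \<sigma> i \<le> j} = S. \<Prod>i\<in>S. y i)"
      by (intro sum.cong refl) auto
    then show "(\<Sum>\<sigma> | \<sigma> \<in> ?P \<and> {i. \<sigma> i \<le> j} = S. \<Prod>i\<in>{i. \<sigma> i \<le> j}. y i) = esym_coeff j * (\<Prod>i\<in>S. y i)"
      using count[OF \<open>S \<in> ?T\<close>] by simp
  qed
  finally show ?thesis by (simp add: esym_def y_def sum_distrib_left)
qed

lemma pos_bij: "bij_betw pos (UNIV :: 'n::{finite,wellorder} set) {1..CARD('n)}"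
proof -
  have mono: "strict_mono (pos :: 'n \<Rightarrow> nat)"
    unfolding strict_mono_def pos_def
  proof (intro allI impI psubset_card_mono)
    fix x y :: 'n assume "x < y"
    then have "y \<in> {k. k \<le> y} - {k. k \<le> x}" "{k. k \<le> x} \<subseteq> {k. k \<le> y}" by auto
    then show "{k. k \<le> x} \<subset> {k. k \<le> y}" by blast
  qed auto
  then have inj: "inj (pos :: 'n \<Rightarrow> nat)" by (simp add: strict_mono_imp_inj_on)
  have "pos j \<in> {1..CARD('n)}" for j :: 'n
    using card_mono[of UNIV "{k. k \<le> j}"] card_gt_0_iff[of "{k. k \<le> j}"]
    unfolding pos_def by fastforce
  then have "pos ` (UNIV :: 'n set) \<subseteq> {1..CARD('n)}" by auto
  moreover have "card (pos ` (UNIV :: 'n set)) = card {1..CARD('n)}"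
    using card_image[OF inj] by simp
  ultimately have "pos ` (UNIV :: 'n set) = {1..CARD('n)}"
    by (intro card_subset_eq) auto
  then show ?thesis using inj by (simp add: bij_betw_def)
qed

lemma pos_surj:
  assumes "1 \<le> k" "k \<le> CARD('n::{finite,wellorder})"
  shows "\<exists>j :: 'n. pos j = k"
  using assms pos_bij[where 'n='n] by (metis atLeastAtMost_iff bij_betw_iff_bijections)

section \<open>Symmetric expressions as polynomials in phi\<close>

lemma X_polys_esym:
  "(\<lambda>x :: real^'n::{finite,wellorder}. esym UNIV k (\<lambda>i. cos (pi * x $ i))) \<in> X_polys"
proof (cases "1 \<le> k \<and> k \<le> CARD('n)")
  case True
  then obtain j :: 'n where j: "pos j = k" using pos_surj[of k] by auto
  have "esym UNIV k (\<lambda>i. cos (pi * x $ i)) = inverse (esym_coeff j) * phi x $ j" for x :: "real^'n::_"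
    using esym_coeff_pos[of j] by (simp add: phi_def Xvar_esym j)
  then show ?thesis using X_polys_mult[OF X_polys_const X_polys_coord[of j]] by simp
next
  case False
  then consider "k = 0" | "k > CARD('n)" by linarith
  then show ?thesis by cases (simp_all add: esym_0 esym_eq_0 X_polys_const)
qed

lemma X_polys_power_sum:
  "(\<lambda>x :: real^'n::{finite,wellorder}. \<Sum>i\<in>UNIV. cos (pi * x $ i) ^ k) \<in> X_polys"
proof (induction k rule: less_induct)
  case (less k)
  let ?y = "\<lambda>x :: real^'n::_. \<lambda>i. cos (pi * x $ i)"
  have eq: "(\<Sum>i\<in>UNIV. ?y x i ^ k) = (- 1) ^ k * ((real CARD('n) - real k) * esym UNIV k (?y x))
     + (\<Sum>l<k. - ((- 1) ^ k) * (- 1) ^ l * ((\<Sum>a\<in>UNIV. ?y x a ^ l) * esym UNIV (k - l) (?y x)))" for x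
  proof -
    have "(\<Sum>i\<in>UNIV. ?y x i ^ k) = (- 1) ^ k * ((- 1) ^ k * (\<Sum>i\<in>UNIV. ?y x i ^ k))"
      by (simp add: mult.assoc[symmetric] power_mult_distrib[symmetric])
    also have "\<dots> = (- 1) ^ k * ((real CARD('n) - real k) * esym UNIV k (?y x))
       - (- 1) ^ k * (\<Sum>l<k. (- 1) ^ l * (\<Sum>a\<in>UNIV. ?y x a ^ l) * esym UNIV (k - l) (?y x))"
      by (subst newton_identity) (simp_all add: right_diff_distrib)
    finally show ?thesis
      by (simp only: diff_conv_add_uminus sum_distrib_left[of "(- 1) ^ k"] sum_negf[symmetric]
          minus_mult_left mult.assoc)
  qed
  show ?case unfolding eq
    by (intro X_polys_add X_polys_sum X_polys_mult X_polys_const X_polys_esym less) auto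
qed

text \<open>Functions of a coordinate \<open>i\<close> and a point \<open>x\<close> that are polynomials in \<open>cos (pi * x $ i)\<close> over the
  ring of polynomials in \<open>phi x\<close>. Summing such a function over all \<open>i\<close> produces power sums, hence a
  polynomial in \<open>phi x\<close>.\<close>

definition coord_X_polys :: "('n \<times> (real^'n::{finite,wellorder}) \<Rightarrow> real) set" where
  "coord_X_polys = fin_sums {(\<lambda>(i, x). a x * cos (pi * x $ i) ^ k) | a k. a \<in> X_polys}"

lemma coord_X_polys_sum_coords:
  assumes "u \<in> coord_X_polys"
  shows "(\<lambda>x. \<Sum>i\<in>UNIV. u (i, x)) \<in> X_polys"
  using assms unfolding coord_X_polys_def
proof induction
  case (step g f)
  then obtain a k where g: "g = (\<lambda>(i, x). a x * cos (pi * x $ i) ^ k)" and a: "a \<in> X_polys" by auto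
  have "(\<lambda>x. \<Sum>i\<in>UNIV. g (i, x)) \<in> X_polys"
    using X_polys_mult[OF a X_polys_power_sum[of k]] by (simp add: g sum_distrib_left)
  from X_polys_add[OF this step(3)] show ?case by (simp add: sum.distrib)
qed (simp add: X_polys_const)

lemma coord_X_polys_add:
  "u \<in> coord_X_polys \<Longrightarrow> v \<in> coord_X_polys \<Longrightarrow> (\<lambda>z. u z + v z) \<in> coord_X_polys"
  unfolding coord_X_polys_def by (rule fin_sums_add)

lemma coord_X_polys_sum:
  "(\<And>l. l \<in> I \<Longrightarrow> u l \<in> coord_X_polys) \<Longrightarrow> (\<lambda>z. \<Sum>l\<in>I. u l z) \<in> coord_X_polys"
  unfolding coord_X_polys_def by (rule fin_sums_sum)

lemma coord_X_polys_mult: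
  assumes "u \<in> coord_X_polys" "v \<in> coord_X_polys"
  shows "(\<lambda>z. u z * v z) \<in> coord_X_polys"
  using assms unfolding coord_X_polys_def
proof (rule fin_sums_mult)
  fix u v :: "'a \<times> (real^'a::{finite,wellorder}) \<Rightarrow> real"
  assume "u \<in> {(\<lambda>(i, x). a x * cos (pi * x $ i) ^ k) | a k. a \<in> X_polys}"
    "v \<in> {(\<lambda>(i, x). a x * cos (pi * x $ i) ^ k) | a k. a \<in> X_polys}"
  then obtain a k b l where u: "u = (\<lambda>(i, x). a x * cos (pi * x $ i) ^ k)" "a \<in> X_polys"
    and v: "v = (\<lambda>(i, x). b x * cos (pi * x $ i) ^ l)" "b \<in> X_polys" by blast
  have "(\<lambda>z. u z * v z) = (\<lambda>(i, x). (a x * b x) * cos (pi * x $ i) ^ (k + l))"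
    by (auto simp: u v power_add fun_eq_iff)
  then show "(\<lambda>z. u z * v z) \<in> fin_sums {(\<lambda>(i, x). a x * cos (pi * x $ i) ^ k) | a k. a \<in> X_polys}"
    using X_polys_mult[OF u(2) v(2)]
    by (intro fin_sums_base CollectI exI[of _ "\<lambda>x. a x * b x"] exI[of _ "k + l"] conjI)
qed

lemma coord_X_polys_of_X_polys:
  assumes "a \<in> X_polys" shows "(\<lambda>(i, x). a x) \<in> coord_X_polys"
  unfolding coord_X_polys_def
  by (rule fin_sums_base) (use assms in \<open>auto intro!: exI[of _ a] exI[of _ 0]\<close>)

lemma coord_X_polys_const: "(\<lambda>z. c) \<in> coord_X_polys"
  using coord_X_polys_of_X_polys[OF X_polys_const[of c]] by (simp add: case_prod_unfold)

lemma coord_X_polys_cos: "(\<lambda>(i, x). cos (pi * x $ i)) \<in> coord_X_polys"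
  unfolding coord_X_polys_def
  by (rule fin_sums_base) (auto intro!: exI[of _ "\<lambda>_. 1"] exI[of _ 1] X_polys_const)

lemma coord_X_polys_power:
  "u \<in> coord_X_polys \<Longrightarrow> (\<lambda>z. u z ^ k) \<in> coord_X_polys"
  by (induction k) (simp_all add: coord_X_polys_const coord_X_polys_mult)

text \<open>Chebyshev's recursion \<open>cos ((k + 2) t) = 2 cos t cos ((k + 1) t) - cos (k t)\<close>.\<close>

lemma coord_X_polys_cos_multiple:
  "(\<lambda>(i, x :: real^'n::{finite,wellorder}). cos (pi * real m * x $ i)) \<in> coord_X_polys"
proof (induction m rule: less_induct)
  case (less m)
  consider "m = 0" | "m = 1" | k where "m = Suc (Suc k)"
    by (metis One_nat_def not0_implies_Suc)
  then show ?case
  proof cases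
    case 3
    have rec: "cos (pi * real m * t) = 2 * (cos (pi * t) * cos (pi * real (Suc k) * t)) + - 1 * cos (pi * real k * t)" for t
      using cos_add[of "pi * real (Suc k) * t" "pi * t"] cos_diff[of "pi * real (Suc k) * t" "pi * t"]
      by (simp add: 3 algebra_simps)
    have IH: "(\<lambda>z :: 'n \<times> (real^'n::_). cos (pi * real (Suc k) * snd z $ fst z)) \<in> coord_X_polys"
      "(\<lambda>z :: 'n \<times> (real^'n::_). cos (pi * real k * snd z $ fst z)) \<in> coord_X_polys"
      using less[of "Suc k"] less[of k] unfolding 3 case_prod_unfold by simp_all
    have "(\<lambda>z :: 'n \<times> (real^'n::_). 2 * (cos (pi * snd z $ fst z) * cos (pi * real (Suc k) * snd z $ fst z))
        + - 1 * cos (pi * real k * snd z $ fst z)) \<in> coord_X_polys"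
      by (intro coord_X_polys_add coord_X_polys_mult coord_X_polys_const IH
          coord_X_polys_cos[unfolded case_prod_unfold])
    then show ?thesis unfolding case_prod_unfold rec .
  qed (simp_all add: coord_X_polys_const coord_X_polys_cos case_prod_unfold coord_X_polys_cos[unfolded case_prod_unfold])
qed

lemma coord_X_polys_esym_without:
  "(\<lambda>(i, x). esym (UNIV - {i}) k (\<lambda>i. cos (pi * x $ i))) \<in> coord_X_polys"
proof -
  have "(\<lambda>z. \<Sum>l\<le>k. (- 1 * (\<lambda>(i, x). cos (pi * x $ i)) z) ^ l *
     (\<lambda>(i, x). esym UNIV (k - l) (\<lambda>i. cos (pi * x $ i))) z) \<in> coord_X_polys"
    by (intro coord_X_polys_sum coord_X_polys_mult coord_X_polys_power coord_X_polys_const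
      coord_X_polys_cos coord_X_polys_of_X_polys X_polys_esym)
  then show ?thesis by (simp add: esym_without case_prod_unfold)
qed

lemma det_sum_coord_X_polys:
  fixes B :: "'n::{finite,wellorder} \<Rightarrow> 'n \<Rightarrow> 'n \<times> (real^'n::_) \<Rightarrow> real"
  assumes "\<And>j l. B j l \<in> coord_X_polys"
  shows "(\<lambda>x. det (\<chi> j l. \<Sum>i\<in>UNIV. B j l (i, x))) \<in> X_polys"
  unfolding det_def
  by (simp, intro X_polys_sum X_polys_mult X_polys_prod X_polys_const coord_X_polys_sum_coords assms)

section \<open>The Jacobian of phi\<close>

lemma phi_differentiable:
  fixes x :: "real^'n::{finite,wellorder}"
  shows "phi differentiable (at x)"
proof -
  have "\<exists>D. ((\<lambda>x :: real^'n::_. Xvar j x) has_derivative D) (at x)" for j :: 'n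
  proof -
    have cosd: "((\<lambda>x :: real^'n::_. cos (pi * l * x $ i)) has_derivative (\<lambda>h. - sin (pi * l * x $ i) * (pi * l * h $ i))) (at x)" for l i
      by (auto intro!: derivative_eq_intros bounded_linear.has_derivative[OF bounded_linear_vec_nth] simp: fun_eq_iff)
    show ?thesis unfolding Xvar_def cos_plus_def
      by (intro exI, rule has_derivative_sum, rule has_derivative_prod, rule cosd)
  qed
  then obtain D where D: "\<And>j :: 'n. ((\<lambda>x :: real^'n::_. Xvar j x) has_derivative D j) (at x)"
    by metis
  have "(phi has_derivative (\<lambda>h. \<chi> j. D j h)) (at x)"
    unfolding has_derivative_componentwise_within[of phi]
    using D by (auto simp: Basis_vec_def inner_axis phi_def)
  then show ?thesis by (rule differentiableI)
qed

text \<open>As a function of \<open>y i\<close> alone, \<open>esym UNIV (Suc k) y\<close> is affine with slope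
  \<open>esym (UNIV - {i}) k y\<close>, so the entry is a derivative along a coordinate line.\<close>

lemma jacobian_phi_entry:
  fixes x :: "real^'n::{finite,wellorder}"
  shows "jacobian phi (at x) $ j $ i =
    esym_coeff j * (- pi * sin (pi * x $ i)) * esym (UNIV - {i}) (pos j - 1) (\<lambda>i. cos (pi * x $ i))"
proof -
  let ?D = "frechet_derivative phi (at x)"
  let ?E = "\<lambda>k. esym (UNIV - {i}) k (\<lambda>i. cos (pi * x $ i))"
  have "(phi has_derivative ?D) (at (x + 0 *\<^sub>R axis i 1))"
    using phi_differentiable[of x] by (simp add: frechet_derivative_works)
  moreover have "((\<lambda>t. x + t *\<^sub>R axis i 1) has_derivative (\<lambda>t. t *\<^sub>R axis i 1)) (at 0)"
    by (auto intro!: derivative_eq_intros)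
  ultimately have "((\<lambda>t. phi (x + t *\<^sub>R axis i 1)) has_derivative (\<lambda>t. ?D (t *\<^sub>R axis i 1))) (at 0)"
    using has_derivative_compose[of "\<lambda>t. x + t *\<^sub>R axis i 1" "\<lambda>t. t *\<^sub>R axis i 1" 0 UNIV phi ?D] by simp
  then have "((\<lambda>t. phi (x + t *\<^sub>R axis i 1) $ j) has_derivative (\<lambda>t. ?D (t *\<^sub>R axis i 1) $ j)) (at 0)"
    by (rule bounded_linear.has_derivative[OF bounded_linear_vec_nth])
  moreover have "?D (t *\<^sub>R axis i 1) $ j = (?D (axis i 1) $ j) * t" for t
    using linear_frechet_derivative[OF phi_differentiable[of x]] by (simp add: linear_scale)
  ultimately have 1: "((\<lambda>t. phi (x + t *\<^sub>R axis i 1) $ j) has_real_derivative ?D (axis i 1) $ j) (at 0)"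
    by (simp add: has_field_derivative_def)
  obtain k where k: "pos j = Suc k"
    using pos_bij[where 'n='n] by (metis UNIV_I atLeastAtMost_iff bij_betwE not0_implies_Suc not_one_le_zero)
  have esym_other: "esym (UNIV - {i}) m (\<lambda>l. cos (pi * (x + t *\<^sub>R axis i 1) $ l)) = ?E m" for m t
    unfolding esym_def by (intro sum.cong refl prod.cong) (auto simp: axis_def)
  have "phi (x + t *\<^sub>R axis i 1) $ j = esym_coeff j * (?E (Suc k) + cos (pi * (x $ i + t)) * ?E k)" for t
    using esym_remove[of UNIV i k "\<lambda>l. cos (pi * (x + t *\<^sub>R axis i 1) $ l)"]
    unfolding esym_other by (simp add: phi_def Xvar_esym k)
  then have "((\<lambda>t. phi (x + t *\<^sub>R axis i 1) $ j) has_real_derivative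
     esym_coeff j * (- pi * sin (pi * x $ i)) * ?E k) (at 0)"
    by (auto intro!: derivative_eq_intros)
  from DERIV_unique[OF 1 this] show ?thesis
    by (simp add: jacobian_def matrix_def k)
qed

lemma Jdet_squared_X_polys: "(\<lambda>x :: real^'n::{finite,wellorder}. (Jdet x)\<^sup>2) \<in> X_polys"
proof -
  define C where "C j = (\<lambda>z :: 'n \<times> (real^'n::_). esym_coeff j * - pi *
    esym (UNIV - {fst z}) (pos j - 1) (\<lambda>i. cos (pi * snd z $ i)))" for j :: 'n
  have C: "C j \<in> coord_X_polys" for j unfolding C_def
    by (intro coord_X_polys_mult coord_X_polys_const coord_X_polys_esym_without[unfolded case_prod_unfold])
  have sin: "(\<lambda>z :: 'n \<times> (real^'n::_). (sin (pi * snd z $ fst z))\<^sup>2) \<in> coord_X_polys"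
  proof -
    have "(\<lambda>z :: 'n \<times> (real^'n::_). 1 + - 1 * cos (pi * snd z $ fst z) ^ 2) \<in> coord_X_polys"
      by (intro coord_X_polys_add coord_X_polys_mult coord_X_polys_const coord_X_polys_power
          coord_X_polys_cos[unfolded case_prod_unfold])
    then show ?thesis by (simp add: sin_squared_eq)
  qed
  have "(Jdet x)\<^sup>2 = det (\<chi> j l. \<Sum>i\<in>UNIV. (sin (pi * x $ i))\<^sup>2 * (C j (i, x) * C l (i, x)))" for x :: "real^'n::_"
  proof -
    let ?M = "jacobian phi (at x)"
    have "(Jdet x)\<^sup>2 = det (?M ** transpose ?M)"
      by (simp add: det_mul det_transpose power2_eq_square Jdet_def)
    also have "?M ** transpose ?M = (\<chi> j l. \<Sum>i\<in>UNIV. (sin (pi * x $ i))\<^sup>2 * (C j (i, x) * C l (i, x)))"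
      by (simp add: matrix_matrix_mult_def transpose_def vec_eq_iff jacobian_phi_entry C_def power2_eq_square mult_ac)
    finally show ?thesis .
  qed
  then show ?thesis
    using det_sum_coord_X_polys[of "\<lambda>j l z. (sin (pi * snd z $ fst z))\<^sup>2 * (C j z * C l z)"]
      coord_X_polys_mult[OF sin coord_X_polys_mult[OF C C]] by simp
qed

text \<open>A vector in the kernel of the Jacobian gives numbers \<open>d i = sin (pi * x $ i) * c $ i\<close> with
  \<open>(\<Sum>i. d i * esym (UNIV - {i}) k y) = 0\<close> for all \<open>k < n\<close>. Collecting these equations in a
  generating function yields \<open>(\<Sum>i. d i * (\<Prod>l\<noteq>i. y l + t)) = 0\<close> for all \<open>t\<close>, a vanishing
  combination of Lagrange basis polynomials; at \<open>t = - y m\<close> only the term \<open>i = m\<close> survives.\<close>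

lemma Jdet_nonzero:
  fixes x :: "real^'n::{finite,wellorder}"
  assumes sin: "\<And>i. sin (pi * x $ i) \<noteq> 0"
    and distinct: "\<And>i j. i \<noteq> j \<Longrightarrow> cos (pi * x $ i) \<noteq> cos (pi * x $ j)"
  shows "Jdet x \<noteq> 0"
proof -
  let ?M = "jacobian phi (at x)" and ?y = "\<lambda>i. cos (pi * x $ i)"
  have "c = 0" if c: "?M *v c = 0" for c
  proof -
    define d where "d i = sin (pi * x $ i) * c $ i" for i
    have esum: "(\<Sum>i\<in>UNIV. d i * esym (UNIV - {i}) k ?y) = 0" if "k < CARD('n)" for k
    proof -
      obtain j :: 'n where j: "pos j = Suc k" using pos_surj[where 'n = 'n and k = "Suc k"] \<open>k < CARD('n)\<close> by auto
      have "0 = (?M *v c) $ j" using c by simp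
      also have "\<dots> = (\<Sum>i\<in>UNIV. (- pi * esym_coeff j) * (d i * esym (UNIV - {i}) k ?y))"
        by (simp add: matrix_vector_mult_def jacobian_phi_entry j d_def mult_ac)
      also have "\<dots> = (- pi * esym_coeff j) * (\<Sum>i\<in>UNIV. d i * esym (UNIV - {i}) k ?y)"
        by (simp only: sum_distrib_left)
      finally show ?thesis using esym_coeff_pos[of j] by simp
    qed
    have gen: "(\<Sum>i\<in>UNIV. d i * (\<Prod>l\<in>UNIV - {i}. ?y l + t)) = 0" for t
    proof -
      have "(\<Sum>i\<in>UNIV. d i * (\<Prod>l\<in>UNIV - {i}. ?y l + t))
        = (\<Sum>i\<in>UNIV. \<Sum>k\<le>CARD('n) - 1. d i * (esym (UNIV - {i}) k ?y * t ^ (CARD('n) - 1 - k)))"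
        by (simp add: prod_add_esym sum_distrib_left card_Diff_singleton)
      also have "\<dots> = (\<Sum>k\<le>CARD('n) - 1. \<Sum>i\<in>UNIV. d i * (esym (UNIV - {i}) k ?y * t ^ (CARD('n) - 1 - k)))"
        by (rule sum.swap)
      also have "\<dots> = (\<Sum>k\<le>CARD('n) - 1. (\<Sum>i\<in>UNIV. d i * esym (UNIV - {i}) k ?y) * t ^ (CARD('n) - 1 - k))"
        by (simp add: sum_distrib_right mult.assoc)
      also have "\<dots> = 0"
      proof (intro sum.neutral ballI)
        fix k assume "k \<in> {..CARD('n) - 1}"
        then have "k < CARD('n)" using zero_less_card_finite[where 'a='n] by (simp add: less_eq_iff_succ_less)
        then show "(\<Sum>i\<in>UNIV. d i * esym (UNIV - {i}) k ?y) * t ^ (CARD('n) - 1 - k) = 0"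
          by (simp add: esum)
      qed
      finally show ?thesis .
    qed
    have "c $ m = 0" for m
    proof -
      \<comment> \<open>for \<open>i \<noteq> m\<close> the product contains the factor \<open>y m - y m\<close>\<close>
      have "(\<Sum>i\<in>UNIV - {m}. d i * (\<Prod>l\<in>UNIV - {i}. ?y l + - ?y m)) = 0"
        by (intro sum.neutral ballI) (auto intro!: bexI[of _ m])
      then have "d m * (\<Prod>l\<in>UNIV - {m}. ?y l + - ?y m) = 0"
        using gen[of "- ?y m"] by (simp add: sum.remove[of UNIV m])
      moreover have "(\<Prod>l\<in>UNIV - {m}. ?y l + - ?y m) \<noteq> 0"
        using distinct by (auto simp: prod_zero_iff)
      ultimately show "c $ m = 0" using sin[of m] by (simp add: d_def)
    qed
    then show "c = 0" by (simp add: vec_eq_iff)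
  qed
  then have "\<exists>B. B ** ?M = mat 1" using matrix_left_invertible_ker by blast
  then show ?thesis unfolding Jdet_def by (metis invertible_det_nz invertible_left_inverse)
qed

lemma cos_minus_squared_X_polys:
  "(\<lambda>x :: real^'n::{finite,wellorder}. (cos_minus rho1 x)\<^sup>2) \<in> X_polys"
proof -
  define R where "R k = (\<lambda>z :: 'n \<times> (real^'n::_). cos (pi * rho1 $ k * snd z $ fst z))" for k :: 'n
  have R: "R k \<in> coord_X_polys" for k
    unfolding R_def rho1_def using coord_X_polys_cos_multiple[unfolded case_prod_unfold] by simp
  have "(cos_minus rho1 x)\<^sup>2 = det (\<chi> j l. \<Sum>i\<in>UNIV. R j (i, x) * R l (i, x))" for x :: "real^'n::_"
  proof -
    let ?M = "(\<chi> i k. R k (i, x)) :: real^'n::_^'n::_"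
    have "(cos_minus rho1 x)\<^sup>2 = (det ?M)\<^sup>2"
      by (simp add: cos_minus_def det_def R_def)
    also have "\<dots> = det (transpose ?M ** ?M)"
      by (simp add: det_mul det_transpose power2_eq_square)
    also have "transpose ?M ** ?M = (\<chi> j l. \<Sum>i\<in>UNIV. R j (i, x) * R l (i, x))"
      by (simp add: matrix_matrix_mult_def transpose_def vec_eq_iff)
    finally show ?thesis .
  qed
  then show ?thesis
    using det_sum_coord_X_polys[of "\<lambda>j l z. R j z * R l z"] coord_X_polys_mult[OF R R] by simp
qed

lemma peval_p_I_plus: "(x :: real^'n::{finite,wellorder}) \<in> Fdom \<Longrightarrow> peval p_I_plus (phi x) = (Jdet x)\<^sup>2"
proof -
  have "\<exists>p. \<forall>x\<in>Fdom :: (real^'n::_) set. peval p (phi x) = (Jdet x)\<^sup>2"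
    using X_polys_peval[OF Jdet_squared_X_polys] by blast
  from someI_ex[OF this] show "x \<in> Fdom \<Longrightarrow> peval p_I_plus (phi x) = (Jdet x)\<^sup>2"
    by (simp add: p_I_plus_def)
qed

lemma peval_J_I_minus: "(x :: real^'n::{finite,wellorder}) \<in> Fdom \<Longrightarrow> peval J_I_minus (phi x) = (cos_minus rho1 x)\<^sup>2"
proof -
  have "\<exists>p. \<forall>x\<in>Fdom :: (real^'n::_) set. peval p (phi x) = (cos_minus rho1 x)\<^sup>2"
    using X_polys_peval[OF cos_minus_squared_X_polys] by blast
  from someI_ex[OF this] show "x \<in> Fdom \<Longrightarrow> peval J_I_minus (phi x) = (cos_minus rho1 x)\<^sup>2"
    by (simp add: J_I_minus_def)
qed

section \<open>Injectivity of phi on the fundamental domain\<close>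

text \<open>If \<open>y i < z i\<close>, then at the level \<open>t = y i\<close> the function \<open>y\<close> has all of \<open>{..i}\<close> below \<open>t\<close>, whereas
  \<open>z\<close> has at most \<open>{..<i}\<close>.\<close>

lemma mono_eq_of_counts_eq:
  fixes y z :: "'n::{finite,linorder} \<Rightarrow> 'a::linorder"
  assumes "mono y" "mono z" and count: "\<And>t. card {i. y i \<le> t} = card {i. z i \<le> t}"
  shows "y = z"
proof -
  have "\<not> y i < z i" if "mono y" "mono z" "\<And>t. card {i. y i \<le> t} = card {i. z i \<le> t}"
    for y z :: "'n \<Rightarrow> 'a" and i
  proof
    assume lt: "y i < z i"
    have "{k. k \<le> i} \<subseteq> {k. y k \<le> y i}" using \<open>mono y\<close> by (auto dest: monoD)
    then have "card {k. k \<le> i} \<le> card {k. y k \<le> y i}" by (rule card_mono[rotated]) simp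
    moreover have "{k. z k \<le> y i} \<subseteq> {k. k < i}"
      using \<open>mono z\<close> lt by (auto simp: not_le[symmetric] dest!: monoD[of z])
    then have "card {k. z k \<le> y i} \<le> card {k. k < i}" by (rule card_mono[rotated]) simp
    moreover have "card {k. k < i} < card {k. k \<le> i}"
      by (rule psubset_card_mono) auto
    ultimately show False using that(3)[of "y i"] by linarith
  qed
  from this[OF assms(1,2) count] this[OF assms(2,1) count[symmetric]] show ?thesis
    by (metis ext linorder_neqE)
qed

text \<open>The symmetric functions of the \<open>y i\<close> are the coefficients of \<open>\<Prod>i. t + y i\<close>, whose roots with
  multiplicity give back the multiset of the \<open>y i\<close>; on \<open>Fdom\<close> the cosines increase with the index,
  and the cosine is injective on \<open>[0, pi]\<close>.\<close>

lemma inj_on_phi: "inj_on phi (Fdom :: (real^'n::{finite,wellorder}) set)"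
proof (rule inj_onI)
  fix x x' :: "real^'n::_" assume x: "x \<in> Fdom" and x': "x' \<in> Fdom" and eq: "phi x = phi x'"
  let ?y = "\<lambda>x :: real^'n::_. \<lambda>i. cos (pi * x $ i)"
  have esym_eq: "esym UNIV k (?y x) = esym UNIV k (?y x')" for k
  proof (cases "1 \<le> k \<and> k \<le> CARD('n)")
    case True
    then obtain j :: 'n where j: "pos j = k" using pos_surj[of k] by auto
    from eq have "phi x $ j = phi x' $ j" by simp
    then show ?thesis using esym_coeff_pos[of j] by (simp add: phi_def Xvar_esym j)
  next
    case False
    then consider "k = 0" | "k > CARD('n)" by linarith
    then show ?thesis by cases (simp_all add: esym_0 esym_eq_0)
  qed
  have "poly (\<Prod>i\<in>UNIV. [:?y x i, 1:]) t = poly (\<Prod>i\<in>UNIV. [:?y x' i, 1:]) t" for t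
    using prod_add_esym[of UNIV "?y x" t] prod_add_esym[of UNIV "?y x'" t] esym_eq
    by (simp add: poly_prod)
  then have "(\<Prod>i\<in>UNIV. [:?y x i, 1:]) = (\<Prod>i\<in>UNIV. [:?y x' i, 1:])"
    by (simp add: poly_eq_poly_eq_iff[symmetric] fun_eq_iff)
  then have "proots (\<Prod>i\<in>UNIV. [:?y x i, 1:]) = proots (\<Prod>i\<in>UNIV. [:?y x' i, 1:])" by simp
  then have ms: "(\<Sum>i\<in>UNIV. {#- ?y x i#}) = (\<Sum>i\<in>UNIV. {#- ?y x' i#})"
    by (simp add: proots_prod)
  have "card {i. ?y x i \<le> t} = card {i. ?y x' i \<le> t}" for t
  proof -
    have "size (filter_mset (\<lambda>u. - u \<le> t) (\<Sum>i\<in>UNIV. {#- ?y x i#})) = card {i. ?y x i \<le> t}" for x :: "real^'n::_"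
    proof -
      have "filter_mset (\<lambda>u. - u \<le> t) (\<Sum>i\<in>A. {#- ?y x i#}) = (\<Sum>i\<in>A. if ?y x i \<le> t then {#- ?y x i#} else {#})"
        for A :: "'n set" by (induction A rule: infinite_finite_induct) auto
      moreover have "size (\<Sum>i\<in>A. if ?y x i \<le> t then {#- ?y x i#} else {#}) = (\<Sum>i\<in>A. if ?y x i \<le> t then 1 else 0)"
        for A :: "'n set" by (induction A rule: infinite_finite_induct) auto
      ultimately show ?thesis by (simp add: sum.If_cases)
    qed
    from this[of x] this[of x'] ms show ?thesis by simp
  qed
  moreover have "mono (?y x)" if "x \<in> Fdom" for x
    using that unfolding Fdom_def
    by (auto intro!: monoI cos_monotone_0_pi_le mult_left_mono simp: mult_le_cancel_left1 mult.commute[of pi])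
  ultimately have "?y x = ?y x'" using x x' by (intro mono_eq_of_counts_eq) auto
  then have "cos (pi * x $ i) = cos (pi * x' $ i)" for i by (rule fun_cong)
  moreover have "0 \<le> pi * x $ i" "pi * x $ i \<le> pi" "0 \<le> pi * x' $ i" "pi * x' $ i \<le> pi" for i
    using x x' by (auto simp: Fdom_def mult_le_cancel_left1)
  ultimately have "pi * x $ i = pi * x' $ i" for i
    using cos_inj_pi by blast
  then show "x = x'" by (simp add: vec_eq_iff)
qed

section \<open>Symmetrization over the strictly decreasing cone\<close>

text \<open>Both the rank \<open>p i\<close> of \<open>v i\<close> from above and the position \<open>q i\<close> of the index \<open>i\<close> are bijections onto
  \<open>{..<n}\<close>; the permutation sends a position to the index with the same rank.\<close>

lemma ex_sorting_permutation:
  fixes v :: "'n::{finite,linorder} \<Rightarrow> 'a::linorder"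
  assumes "inj v"
  shows "\<exists>\<sigma>. \<sigma> permutes UNIV \<and> (\<forall>i j. i < j \<longrightarrow> v (\<sigma> j) < v (\<sigma> i))"
proof -
  define p where "p i = card {k. v i < v k}" for i
  define q where "q i = card {k. k < i}" for i :: 'n
  have p_less: "p i < p j" if "v j < v i" for i j
    unfolding p_def
  proof (rule psubset_card_mono)
    have "i \<in> {k. v j < v k} - {k. v i < v k}" "{k. v i < v k} \<subseteq> {k. v j < v k}" using that by auto
    then show "{k. v i < v k} \<subset> {k. v j < v k}" by blast
  qed simp
  have q_less: "q i < q j" if "i < j" for i j
    unfolding q_def
  proof (rule psubset_card_mono)
    have "i \<in> {k. k < j} - {k. k < i}" "{k. k < i} \<subseteq> {k. k < j}" using that by auto
    then show "{k. k < i} \<subset> {k. k < j}" by blast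
  qed simp
  have "inj p" by (rule injI) (metis p_less assms injD less_irrefl linorder_neqE)
  have "inj q" by (rule injI) (metis q_less less_irrefl linorder_neqE)
  have less: "card {k. P k} < CARD('n)" if "\<not> P i" for P :: "'n \<Rightarrow> bool" and i
    by (rule psubset_card_mono) (use that in auto)
  have "p i < CARD('n)" "q i < CARD('n)" for i
    unfolding p_def q_def by (rule less[of _ i], simp)+
  note less = this
  have "p ` UNIV = {..<CARD('n)}"
    by (rule card_subset_eq) (use less(1) card_image[OF \<open>inj p\<close>] in auto)
  then have p: "bij_betw p UNIV {..<CARD('n)}" using \<open>inj p\<close> by (simp add: bij_betw_def)
  have "q ` UNIV = {..<CARD('n)}"
    by (rule card_subset_eq) (use less(2) card_image[OF \<open>inj q\<close>] in auto)
  then have q: "bij_betw q UNIV {..<CARD('n)}" using \<open>inj q\<close> by (simp add: bij_betw_def)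
  define \<sigma> where "\<sigma> = inv_into UNIV p \<circ> q"
  have "bij_betw \<sigma> UNIV UNIV"
    unfolding \<sigma>_def by (rule bij_betw_trans[OF q bij_betw_inv_into[OF p]])
  then have "\<sigma> permutes UNIV" by (intro bij_imp_permutes) auto
  moreover have p\<sigma>: "p (\<sigma> i) = q i" for i
    using p q by (auto simp: \<sigma>_def bij_betw_def intro!: f_inv_into_f)
  have "v (\<sigma> j) < v (\<sigma> i)" if "i < j" for i j
  proof (rule ccontr)
    assume "\<not> v (\<sigma> j) < v (\<sigma> i)"
    then have "p (\<sigma> j) \<le> p (\<sigma> i)"
    proof (cases "v (\<sigma> i) = v (\<sigma> j)")
      case True
      then show ?thesis by (simp add: p_def)
    next
      case False
      with \<open>\<not> v (\<sigma> j) < v (\<sigma> i)\<close> have "v (\<sigma> i) < v (\<sigma> j)" by (auto simp: not_less le_less)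
      from p_less[OF this] show ?thesis by simp
    qed
    then show False using q_less[OF that] by (simp add: p\<sigma>)
  qed
  ultimately show ?thesis by blast
qed

lemma sorting_permutation_unique:
  fixes v :: "'n::{finite,linorder} \<Rightarrow> 'a::linorder"
  assumes "\<sigma> permutes UNIV" "\<tau> permutes UNIV"
    and \<sigma>: "\<And>i j. i < j \<Longrightarrow> v (\<sigma> j) < v (\<sigma> i)" and \<tau>: "\<And>i j. i < j \<Longrightarrow> v (\<tau> j) < v (\<tau> i)"
  shows "\<sigma> = \<tau>"
proof -
  define h where "h = inv \<sigma> \<circ> \<tau>"
  have h: "\<sigma> (h i) = \<tau> i" for i using assms(1) by (simp add: h_def permutes_inverses)
  have "i < j \<Longrightarrow> h i < h j" for i j
  proof (rule ccontr)
    assume "i < j" "\<not> h i < h j"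
    then have "v (\<sigma> (h i)) \<le> v (\<sigma> (h j))"
      using \<sigma>[of "h j" "h i"] by (cases "h i = h j") (auto intro: less_imp_le)
    then show False using \<tau>[OF \<open>i < j\<close>] by (simp add: h)
  qed
  then have mono: "mono h" by (metis monoI order_le_less)
  have bij: "bij h" unfolding h_def using assms(1,2) by (intro bij_comp permutes_bij permutes_inv)
  have "card {i. h i \<le> t} = card {i. i \<le> t}" for t
  proof -
    have "h ` {i. h i \<le> t} = {i. i \<le> t}" using bij by (auto simp: bij_def image_iff surj_def)
    then show ?thesis using bij card_image[of h "{i. h i \<le> t}"] by (auto simp: bij_def inj_on_subset)
  qed
  then have "h = (\<lambda>i. i)" by (intro mono_eq_of_counts_eq mono) (auto simp: mono_def)
  with h show ?thesis by (auto simp: fun_eq_iff)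
qed

definition permute_coords :: "('n \<Rightarrow> 'n) \<Rightarrow> 'a^'n \<Rightarrow> 'a^'n" where
  "permute_coords \<sigma> v = (\<chi> i. v $ \<sigma> i)"

definition strict_cone :: "'a::linorder set \<Rightarrow> ('a^'n::{finite,wellorder}) set" where
  "strict_cone R = {v. (\<forall>i. v $ i \<in> R) \<and> (\<forall>i j. i < j \<longrightarrow> v $ j < v $ i)}"

lemma permute_coords_inverse:
  assumes "\<sigma> permutes UNIV"
  shows "permute_coords (inv \<sigma>) (permute_coords \<sigma> v) = v" "permute_coords \<sigma> (permute_coords (inv \<sigma>) v) = v"
  using assms by (auto simp: permute_coords_def vec_eq_iff permutes_inverses)

lemma strict_cone_inj:
  assumes "v \<in> strict_cone R" shows "inj (($) v)"
proof (rule injI, rule ccontr)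
  fix i j assume "v $ i = v $ j" "i \<noteq> j"
  moreover have "v $ j < v $ i \<or> v $ i < v $ j"
    using \<open>i \<noteq> j\<close> assms by (cases "i < j") (auto simp: strict_cone_def not_less le_less)
  ultimately show False by simp
qed

text \<open>Together with \<open>permuted_cones_disjoint\<close> this partitions the vectors with distinct entries into
  \<open>n!\<close> permuted copies of the cone. It is used for the integer node grid and for the real cube.\<close>

lemma injective_vectors_eq:
  "{v :: 'a::linorder^'n::{finite,wellorder}. (\<forall>i. v $ i \<in> R) \<and> inj (($) v)} =
    (\<Union>\<sigma>\<in>{\<sigma>. \<sigma> permutes UNIV}. permute_coords \<sigma> ` strict_cone R)"
proof (intro equalityI subsetI)
  fix v :: "'a^'n::_" assume v: "v \<in> {v. (\<forall>i. v $ i \<in> R) \<and> inj (($) v)}"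
  then obtain \<sigma> where \<sigma>: "\<sigma> permutes UNIV" "\<forall>i j. i < j \<longrightarrow> v $ \<sigma> j < v $ \<sigma> i"
    using ex_sorting_permutation[of "($) v"] by auto
  then have "permute_coords \<sigma> v \<in> strict_cone R" using v by (auto simp: strict_cone_def permute_coords_def)
  then have "v \<in> permute_coords (inv \<sigma>) ` strict_cone R"
    using permute_coords_inverse(1)[OF \<sigma>(1), of v] by (metis image_eqI)
  then show "v \<in> (\<Union>\<sigma>\<in>{\<sigma>. \<sigma> permutes UNIV}. permute_coords \<sigma> ` strict_cone R)"
    using permutes_inv[OF \<sigma>(1)] by blast
next
  fix v :: "'a^'n::_" assume "v \<in> (\<Union>\<sigma>\<in>{\<sigma>. \<sigma> permutes UNIV}. permute_coords \<sigma> ` strict_cone R)"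
  then obtain \<sigma> w where w: "\<sigma> permutes UNIV" "w \<in> strict_cone R" "v = permute_coords \<sigma> w" by auto
  then have "inj (\<lambda>i. w $ \<sigma> i)"
    using inj_compose[OF strict_cone_inj[OF w(2)] permutes_inj[OF w(1)]] by (simp add: comp_def)
  then have "inj (($) v)" using w by (simp add: permute_coords_def inj_def)
  then show "v \<in> {v. (\<forall>i. v $ i \<in> R) \<and> inj (($) v)}"
    using w by (auto simp: permute_coords_def strict_cone_def)
qed

lemma permuted_cones_disjoint:
  assumes "\<sigma> permutes UNIV" "\<tau> permutes UNIV" "\<sigma> \<noteq> \<tau>"
  shows "permute_coords \<sigma> ` strict_cone R \<inter> permute_coords \<tau> ` strict_cone R = {}"
proof (rule ccontr)
  assume "\<not> ?thesis"
  then obtain v u w where u: "u \<in> strict_cone R" "v = permute_coords \<sigma> u"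
    and w: "w \<in> strict_cone R" "v = permute_coords \<tau> w" by blast
  have "u = permute_coords (inv \<sigma>) v" "w = permute_coords (inv \<tau>) v"
    using u w assms permute_coords_inverse by metis+
  then have "v $ inv \<sigma> j < v $ inv \<sigma> i" "v $ inv \<tau> j < v $ inv \<tau> i" if "i < j" for i j
    using u(1) w(1) that by (auto simp: strict_cone_def permute_coords_def)
  then have "inv \<sigma> = inv \<tau>"
    using assms by (intro sorting_permutation_unique[of _ _ "($) v"] permutes_inv) auto
  then show False using assms by (metis permutes_inv_inv)
qed

lemma inj_permute_coords: "\<sigma> permutes UNIV \<Longrightarrow> inj_on (permute_coords \<sigma>) A"
  by (rule inj_on_inverseI[of _ "permute_coords (inv \<sigma>)"]) (rule permute_coords_inverse)

lemma sum_symmetric: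
  fixes g :: "'a::linorder^'n::{finite,wellorder} \<Rightarrow> real"
  assumes "finite R"
    and sym: "\<And>\<sigma> v. \<sigma> permutes UNIV \<Longrightarrow> g (permute_coords \<sigma> v) = g v"
    and vanish: "\<And>v. \<not> inj (($) v) \<Longrightarrow> g v = 0"
  shows "(\<Sum>v | \<forall>i. v $ i \<in> R. g v) = fact CARD('n) * (\<Sum>v\<in>strict_cone R. g v)"
proof -
  let ?P = "{\<sigma> :: 'n \<Rightarrow> 'n. \<sigma> permutes UNIV}"
  have "finite ((($) :: 'a^'n::_ \<Rightarrow> 'n \<Rightarrow> 'a) -` (PiE UNIV (\<lambda>_. R)))"
    by (rule finite_vimageI) (use assms(1) in \<open>auto simp: inj_def vec_eq_iff fun_eq_iff finite_PiE\<close>)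
  then have fin: "finite {v :: 'a^'n::_. \<forall>i. v $ i \<in> R}"
    by (simp add: vimage_def PiE_def Pi_def)
  then have fin_cone: "finite (strict_cone R :: ('a^'n::_) set)"
    by (rule finite_subset[rotated]) (auto simp: strict_cone_def)
  have "(\<Sum>v | \<forall>i. v $ i \<in> R. g v) = (\<Sum>v | (\<forall>i. v $ i \<in> R) \<and> inj (($) v). g v)"
    by (rule sum.mono_neutral_right[OF fin]) (use vanish in blast)+
  also have "\<dots> = (\<Sum>\<sigma>\<in>?P. \<Sum>v\<in>permute_coords \<sigma> ` strict_cone R. g v)"
    unfolding injective_vectors_eq
  proof (rule sum.UNION_disjoint)
    show "\<forall>\<sigma>\<in>?P. \<forall>\<tau>\<in>?P. \<sigma> \<noteq> \<tau> \<longrightarrow> permute_coords \<sigma> ` strict_cone R \<inter> permute_coords \<tau> ` strict_cone R = {}"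
      by (intro ballI impI permuted_cones_disjoint) auto
  qed (simp_all add: fin_cone finite_permutations)
  also have "\<dots> = (\<Sum>\<sigma>\<in>?P. \<Sum>v\<in>strict_cone R. g v)"
    by (rule sum.cong[OF refl]) (simp add: sum.reindex inj_permute_coords sym)
  also have "\<dots> = fact CARD('n) * (\<Sum>v\<in>strict_cone R. g v)"
    by (simp add: card_permutations)
  finally show ?thesis .
qed

lemma negligible_coords_eq: "(i :: 'n::finite) \<noteq> j \<Longrightarrow> negligible {x :: real^'n. x $ i = x $ j}"
proof -
  assume "i \<noteq> j"
  then have "axis i 1 - axis j 1 \<noteq> (0 :: real^'n)" by (auto simp: vec_eq_iff axis_def)
  from negligible_hyperplane[OF disjI1[OF this], of 0] show ?thesis
    by (simp add: inner_diff_left inner_axis' algebra_simps)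
qed

lemma negligible_coord_eq_const: "negligible {x :: real^'n::finite. x $ i = c}"
proof -
  have "axis i 1 \<noteq> (0 :: real^'n)" by (auto simp: vec_eq_iff axis_def)
  from negligible_hyperplane[OF disjI1[OF this], of c] show ?thesis
    by (simp add: inner_axis')
qed

lemma negligible_noninjective: "negligible {x :: real^'n::finite. \<not> inj (($) x)}"
proof -
  have "{x :: real^'n. \<not> inj (($) x)} = (\<Union>(i, j)\<in>{(i, j). i \<noteq> j}. {x. x $ i = x $ j})"
    by (auto simp: inj_def)
  moreover have "negligible (\<Union>(i, j)\<in>{(i :: 'n, j). i \<noteq> j}. {x :: real^'n. x $ i = x $ j})"
    by (rule negligible_Union) (auto simp: negligible_coords_eq)
  ultimately show ?thesis by simp
qed

text \<open>The real-valued form of the change of variables formula for vector-valued functions, transferred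
  through \<open>real^1\<close>.\<close>

lemma has_integral_image:
  fixes f :: "real^'m::{finite,wellorder} \<Rightarrow> real" and g :: "real^'m::_ \<Rightarrow> real^'m::_"
  assumes S: "S \<in> sets lebesgue"
    and der: "\<And>x. x \<in> S \<Longrightarrow> (g has_derivative g' x) (at x within S)"
    and inj: "inj_on g S"
    and int: "(\<lambda>x. \<bar>det (matrix (g' x))\<bar> * f (g x)) absolutely_integrable_on S"
  shows "(f has_integral integral S (\<lambda>x. \<bar>det (matrix (g' x))\<bar> * f (g x))) (g ` S)"
proof -
  let ?u = "\<lambda>x. \<bar>det (matrix (g' x))\<bar> * f (g x)" and ?v = "vec :: real \<Rightarrow> real^1"
  have lin: "bounded_linear ?v" by (simp add: linear_conv_bounded_linear[symmetric])
  have "(?v \<circ> ?u) absolutely_integrable_on S"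
    using int lin by (rule absolutely_integrable_linear)
  moreover have "integral S (?v \<circ> ?u) = ?v (integral S ?u)"
    using int lin by (intro integral_linear) (auto dest: set_lebesgue_integral_eq_integral(1))
  moreover have "?v \<circ> ?u = (\<lambda>x. \<bar>det (matrix (g' x))\<bar> *\<^sub>R (?v (f (g x))))"
    by (auto simp: fun_eq_iff vec_eq_iff)
  ultimately have "(\<lambda>y. ?v (f y)) absolutely_integrable_on (g ` S) \<and> integral (g ` S) (\<lambda>y. ?v (f y)) = ?v (integral S ?u)"
    using has_absolute_integral_change_of_variables[OF S der inj, of "\<lambda>y. ?v (f y)" "?v (integral S ?u)"] by simp
  then have "((\<lambda>y. ?v (f y)) has_integral ?v (integral S ?u)) (g ` S)"
    by (metis has_integral_integrable_integral set_lebesgue_integral_eq_integral(1))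
  from has_integral_linear[OF this bounded_linear_vec_nth[of 1]] show ?thesis
    by (simp add: comp_def)
qed

lemma has_integral_permute_coords:
  fixes h :: "real^'n::{finite,wellorder} \<Rightarrow> real"
  assumes \<sigma>: "\<sigma> permutes UNIV" and S: "S \<in> sets lebesgue"
    and sym: "\<And>v. h (permute_coords \<sigma> v) = h v"
    and h: "h absolutely_integrable_on S"
  shows "(h has_integral integral S h) (permute_coords \<sigma> ` S)"
proof -
  have lin: "linear (permute_coords \<sigma> :: real^'n::_ \<Rightarrow> _)"
    by (rule linearI) (auto simp: permute_coords_def vec_eq_iff)
  have "matrix (permute_coords \<sigma>) = ((\<chi> i. mat 1 $ \<sigma> i) :: real^'n::_^'n::_)"
    by (auto simp: matrix_def permute_coords_def vec_eq_iff mat_def axis_def)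
  then have det: "\<bar>det (matrix (permute_coords \<sigma> :: real^'n::_ \<Rightarrow> _))\<bar> = 1"
    using det_permute_rows[OF \<sigma>, of "mat 1 :: real^'n::_^'n::_"] by (simp add: sign_def)
  have der: "(permute_coords \<sigma> has_derivative permute_coords \<sigma>) (at x within S)" for x :: "real^'n::_"
    using lin by (simp add: bounded_linear_imp_has_derivative linear_conv_bounded_linear)
  show ?thesis
    using has_integral_image[OF S der inj_permute_coords[OF \<sigma>], of h] h by (simp add: det sym)
qed

lemma closed_Fdom: "closed (Fdom :: (real^'n::{finite,wellorder}) set)"
proof -
  have "Fdom = (\<Inter>i. {x :: real^'n::_. 0 \<le> x $ i}) \<inter> (\<Inter>i. {x. x $ i \<le> 1}) \<inter>
      (\<Inter>(i, j)\<in>{(i, j). i \<le> j}. {x. x $ j \<le> x $ i})"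
    by (auto simp: Fdom_def)
  moreover have "closed \<dots>"
    by (intro closed_Int closed_INT ballI) (auto intro!: closed_Collect_le continuous_intros)
  ultimately show ?thesis by simp
qed

lemma strict_cone_unit: "strict_cone {0..1} = {x \<in> Fdom. inj (($) (x :: real^'n::{finite,wellorder}))}"
proof (intro equalityI subsetI)
  fix x :: "real^'n::_" assume "x \<in> strict_cone {0..1}"
  then show "x \<in> {x \<in> Fdom. inj (($) x)}"
    using strict_cone_inj[of x "{0..1}"] by (auto simp: strict_cone_def Fdom_def le_less)
next
  fix x :: "real^'n::_" assume x: "x \<in> {x \<in> Fdom. inj (($) x)}"
  then have "x $ j < x $ i" if "i < j" for i j
    using that by (auto simp: Fdom_def inj_def less_le)
  then show "x \<in> strict_cone {0..1}" using x by (auto simp: strict_cone_def Fdom_def)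
qed

lemma Fdom_lebesgue: "Fdom \<in> sets (lebesgue :: (real^'n::{finite,wellorder}) measure)"
  by (metis borel_closed closed_Fdom sets_completionI_sets sets_lborel)

lemma strict_cone_lebesgue: "strict_cone {0..1} \<in> sets (lebesgue :: (real^'n::{finite,wellorder}) measure)"
proof -
  have "strict_cone {0..1} = Fdom - {x :: real^'n::_. \<not> inj (($) x)}"
    by (auto simp: strict_cone_unit)
  then show ?thesis
    using sets.Diff[OF Fdom_lebesgue negligible_imp_sets[OF negligible_noninjective]] by simp
qed

text \<open>The points with two equal coordinates form a null set, and by symmetry each of the \<open>n!\<close>
  permuted copies of the cone contributes the same integral.\<close>

lemma integral_symmetric:
  fixes h :: "real^'n::{finite,wellorder} \<Rightarrow> real"
  assumes cont: "continuous_on UNIV h"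
    and sym: "\<And>\<sigma> v. \<sigma> permutes UNIV \<Longrightarrow> h (permute_coords \<sigma> v) = h v"
  shows "h absolutely_integrable_on Fdom"
    and "integral (cbox 0 1) h = fact CARD('n) * integral Fdom h"
proof -
  have cube: "cbox 0 1 = {x :: real^'n::_. \<forall>i. x $ i \<in> {0..1}}"
    by (auto simp: mem_box_cart)
  have h_cube: "h absolutely_integrable_on cbox 0 1"
    using cont by (intro absolutely_integrable_continuous) (auto intro: continuous_on_subset)
  then show "h absolutely_integrable_on Fdom"
    by (rule set_integrable_subset) (use closed_Fdom in \<open>auto simp: cube Fdom_def\<close>)
  have h_cone: "h absolutely_integrable_on strict_cone {0..1}"
    using h_cube strict_cone_lebesgue by (rule set_integrable_subset) (auto simp: cube strict_cone_def)
  let ?P = "{\<sigma> :: 'n \<Rightarrow> 'n. \<sigma> permutes UNIV}"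
  have "(h has_integral (\<Sum>\<sigma>\<in>?P. integral (strict_cone {0..1}) h)) (\<Union>\<sigma>\<in>?P. permute_coords \<sigma> ` strict_cone {0..1})"
    by (rule has_integral_UN)
       (simp_all add: finite_permutations pairwise_def permuted_cones_disjoint
          has_integral_permute_coords sym strict_cone_lebesgue h_cone)
  then have "(h has_integral fact CARD('n) * integral (strict_cone {0..1}) h)
      {x. (\<forall>i. x $ i \<in> {0..1}) \<and> inj (($) x)}"
    unfolding injective_vectors_eq by (simp add: card_permutations)
  moreover have n1: "negligible {x \<in> cbox 0 1 - {x. (\<forall>i. x $ i \<in> {0..1}) \<and> inj (($) x)}. h x \<noteq> 0}"
    by (rule negligible_subset[OF negligible_noninjective]) (auto simp: cube)
  moreover have n2: "negligible {x \<in> {x. (\<forall>i. x $ i \<in> {0..1}) \<and> inj (($) x)} - cbox 0 1. h x \<noteq> 0}"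
    by (rule negligible_subset[OF negligible_empty]) (unfold cube, blast)
  ultimately have "(h has_integral fact CARD('n) * integral (strict_cone {0..1}) h) (cbox 0 1)"
    using has_integral_spike_set_eq[OF n1 n2] by blast
  moreover have "integral Fdom h = integral (strict_cone {0..1}) h"
    by (rule integral_spike_set) (auto intro!: negligible_subset[OF negligible_noninjective] simp: strict_cone_unit)
  ultimately show "integral (cbox 0 1) h = fact CARD('n) * integral Fdom h"
    by (simp add: integral_unique)
qed

section \<open>Cosine polynomials and integration over the unit cube\<close>

definition trig_poly :: "nat \<Rightarrow> (real \<Rightarrow> real) set" where
  "trig_poly d = fin_sums {(\<lambda>t. c * cos (pi * real k * t)) | c k. k \<le> d}"

definition trig_polys :: "nat \<Rightarrow> (real^'n::finite \<Rightarrow> real) set" where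
  "trig_polys d = fin_sums {(\<lambda>x. \<Prod>i\<in>UNIV. g i (x $ i)) | g. \<forall>i. g i \<in> trig_poly d}"

lemma trig_poly_cos: "k \<le> d \<Longrightarrow> (\<lambda>t. c * cos (pi * real k * t)) \<in> trig_poly d"
  unfolding trig_poly_def by (rule fin_sums_base) blast

lemma trig_poly_mono: "d \<le> e \<Longrightarrow> trig_poly d \<subseteq> trig_poly e"
  unfolding trig_poly_def by (rule fin_sums_mono) (blast intro: order_trans)

lemma trig_poly_mult:
  assumes "f \<in> trig_poly a" "g \<in> trig_poly b"
  shows "(\<lambda>t. f t * g t) \<in> trig_poly (a + b)"
  using assms unfolding trig_poly_def
proof (rule fin_sums_mult)
  fix u v :: "real \<Rightarrow> real"
  assume "u \<in> {(\<lambda>t. c * cos (pi * real k * t)) | c k. k \<le> a}"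
    "v \<in> {(\<lambda>t. c * cos (pi * real k * t)) | c k. k \<le> b}"
  then obtain c k d l where u: "u = (\<lambda>t. c * cos (pi * real k * t))" "k \<le> a"
    and v: "v = (\<lambda>t. d * cos (pi * real l * t))" "l \<le> b" by blast
  define m where "m = nat \<bar>int k - int l\<bar>"
  have diff: "cos (pi * real m * t) = cos (pi * real k * t - pi * real l * t)" for t
  proof (cases "k \<le> l")
    case True
    then have "pi * real m * t = - (pi * real k * t - pi * real l * t)" by (simp add: m_def of_nat_diff nat_diff_distrib algebra_simps)
    then show ?thesis by (metis cos_minus)
  qed (simp add: m_def of_nat_diff nat_diff_distrib algebra_simps)
  have add: "cos (pi * real (k + l) * t) = cos (pi * real k * t + pi * real l * t)" for t
    by (simp add: algebra_simps)
  have "u t * v t = c * d / 2 * cos (pi * real (k + l) * t) + c * d / 2 * cos (pi * real m * t)" for t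
  proof -
    have "c * cos x * (d * cos y) = c * d / 2 * cos (x + y) + c * d / 2 * cos (x - y)" for x y
      by (simp add: cos_add cos_diff field_simps)
    from this[of "pi * real k * t" "pi * real l * t"]
    show ?thesis unfolding u v by (simp only: diff add)
  qed
  then have "(\<lambda>t. u t * v t) = (\<lambda>t. c * d / 2 * cos (pi * real (k + l) * t) + c * d / 2 * cos (pi * real m * t))"
    by blast
  moreover have "\<dots> \<in> trig_poly (a + b)"
    unfolding trig_poly_def
    by (intro fin_sums_add trig_poly_cos[unfolded trig_poly_def]) (use u(2) v(2) in \<open>auto simp: m_def\<close>)
  ultimately show "(\<lambda>t. u t * v t) \<in> fin_sums {(\<lambda>t. c * cos (pi * real k * t)) | c k. k \<le> a + b}"
    by (simp add: trig_poly_def)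
qed

lemma trig_poly_const: "(\<lambda>t. c) \<in> trig_poly d"
  using trig_poly_cos[of 0 d c] by simp

lemma trig_poly_continuous: "f \<in> trig_poly d \<Longrightarrow> continuous_on A f"
  unfolding trig_poly_def
proof (induction rule: fin_sums.induct)
  case (step g f)
  then show ?case by (auto intro!: continuous_intros)
qed simp

lemma trig_polys_prod_coords: "(\<And>i. g i \<in> trig_poly d) \<Longrightarrow> (\<lambda>x. \<Prod>i\<in>UNIV. g i (x $ i)) \<in> trig_polys d"
  unfolding trig_polys_def by (rule fin_sums_base) blast

lemma trig_polys_mono: "d \<le> e \<Longrightarrow> trig_polys d \<subseteq> trig_polys e"
  unfolding trig_polys_def by (rule fin_sums_mono) (use trig_poly_mono[of d e] in blast)

lemma trig_polys_sum:
  "(\<And>i. i \<in> I \<Longrightarrow> f i \<in> trig_polys d) \<Longrightarrow> (\<lambda>x. \<Sum>i\<in>I. f i x) \<in> trig_polys d"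
  unfolding trig_polys_def by (rule fin_sums_sum)

lemma trig_polys_mult:
  fixes f g :: "real^'n::finite \<Rightarrow> real"
  assumes "f \<in> trig_polys a" "g \<in> trig_polys b"
  shows "(\<lambda>x. f x * g x) \<in> trig_polys (a + b)"
  using assms unfolding trig_polys_def
proof (rule fin_sums_mult)
  fix u v :: "real^'n::finite \<Rightarrow> real"
  assume "u \<in> {(\<lambda>x. \<Prod>i\<in>UNIV. g i (x $ i)) | g. \<forall>i. g i \<in> trig_poly a}"
    "v \<in> {(\<lambda>x. \<Prod>i\<in>UNIV. g i (x $ i)) | g. \<forall>i. g i \<in> trig_poly b}"
  then obtain g h where u: "u = (\<lambda>x. \<Prod>i\<in>UNIV. g i (x $ i))" "\<forall>i. g i \<in> trig_poly a"
    and v: "v = (\<lambda>x. \<Prod>i\<in>UNIV. h i (x $ i))" "\<forall>i. h i \<in> trig_poly b" by blast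
  have "(\<lambda>x. u x * v x) = (\<lambda>x. \<Prod>i\<in>UNIV. (\<lambda>i t. g i t * h i t) i (x $ i))"
    by (simp add: u v prod.distrib)
  also have "\<dots> \<in> trig_polys (a + b)"
    using u(2) v(2) by (intro trig_polys_prod_coords) (auto intro: trig_poly_mult)
  finally show "(\<lambda>x. u x * v x) \<in> fin_sums {(\<lambda>x. \<Prod>i\<in>UNIV. g i (x $ i)) | g. \<forall>i. g i \<in> trig_poly (a + b)}"
    by (simp add: trig_polys_def)
qed

lemma trig_polys_const: "(\<lambda>x :: real^'n::finite. c) \<in> trig_polys d"
proof -
  define g where "g i = (\<lambda>t :: real. if i = undefined then c else 1)" for i :: 'n
  have "g i \<in> trig_poly d" for i by (simp add: g_def trig_poly_const)
  then have "(\<lambda>x :: real^'n. \<Prod>i\<in>UNIV. g i (x $ i)) \<in> trig_polys d"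
    by (rule trig_polys_prod_coords)
  moreover have "(\<Prod>i\<in>UNIV. g i (x $ i)) = c" for x :: "real^'n"
    by (simp add: g_def)
  ultimately show ?thesis by simp
qed

lemma trig_polys_prod:
  "(\<And>i. i \<in> I \<Longrightarrow> f i \<in> trig_polys (d i)) \<Longrightarrow> (\<lambda>x. \<Prod>i\<in>I. f i x) \<in> trig_polys (\<Sum>i\<in>I. d i)"
proof (induction I rule: infinite_finite_induct)
  case (insert i I)
  then have "(\<lambda>x. f i x * (\<Prod>j\<in>I. f j x)) \<in> trig_polys (d i + (\<Sum>j\<in>I. d j))"
    by (intro trig_polys_mult) auto
  with insert.hyps show ?case by simp
qed (simp_all add: trig_polys_const)

lemma trig_polys_power:
  assumes "f \<in> trig_polys d" shows "(\<lambda>x. f x ^ m) \<in> trig_polys (m * d)"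
proof -
  have "(\<lambda>x. \<Prod>i<m. f x) \<in> trig_polys (\<Sum>i<m. d)"
    by (rule trig_polys_prod) (rule assms)
  then show ?thesis by simp
qed

lemma trig_polys_continuous: "f \<in> trig_polys d \<Longrightarrow> continuous_on A f"
  unfolding trig_polys_def
proof (induction rule: fin_sums.induct)
  case (step g f)
  then obtain u where g: "g = (\<lambda>x. \<Prod>i\<in>UNIV. u i (x $ i))" and u: "\<And>i. u i \<in> trig_poly d" by auto
  have "continuous_on A (\<lambda>x. u i (x $ i))" for i
    by (rule continuous_on_compose2[OF trig_poly_continuous[OF u, of UNIV]])
       (auto intro!: continuous_intros)
  then have "continuous_on A g" unfolding g by (rule continuous_on_prod)
  then show ?case using step(3) by (rule continuous_on_add)
qed simp

lemma trig_polys_phi: "(\<lambda>x :: real^'n::{finite,wellorder}. phi x $ j) \<in> trig_polys 1"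
proof -
  have "(\<lambda>x :: real^'n::_. \<Prod>i\<in>UNIV. (\<lambda>i t. cos (pi * (\<chi> i. if i \<le> j then 1 else 0) $ \<sigma> i * t)) i (x $ i)) \<in> trig_polys 1" for \<sigma>
  proof (rule trig_polys_prod_coords)
    fix i
    show "(\<lambda>t. cos (pi * (\<chi> i. if i \<le> j then 1 else 0) $ \<sigma> i * t)) \<in> trig_poly 1"
      using trig_poly_cos[of 1 1 1] trig_poly_cos[of 0 1 1] by (cases "\<sigma> i \<le> j") simp_all
  qed
  then show ?thesis unfolding phi_def Xvar_def cos_plus_def by (simp add: trig_polys_sum)
qed

lemma trig_polys_cos_minus:
  "(cos_minus rho1 :: real^'n::{finite,wellorder} \<Rightarrow> real) \<in> trig_polys (CARD('n) - 1)"
proof -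
  have "(\<lambda>x :: real^'n::_. \<Prod>i\<in>UNIV. (\<lambda>i t. cos (pi * rho1 $ \<sigma> i * t)) i (x $ i)) \<in> trig_polys (CARD('n) - 1)"
    for \<sigma> :: "'n \<Rightarrow> 'n"
  proof (rule trig_polys_prod_coords)
    fix i
    have "card {k. \<sigma> i < k} < CARD('n)" by (rule psubset_card_mono) auto
    then show "(\<lambda>t. cos (pi * rho1 $ \<sigma> i * t)) \<in> trig_poly (CARD('n) - 1)"
      using trig_poly_cos[of "card {k. \<sigma> i < k}" "CARD('n) - 1" 1] by (simp add: rho1_def)
  qed
  then have "(\<lambda>x :: real^'n::_. of_int (sign \<sigma>) * (\<Prod>i\<in>UNIV. cos (pi * rho1 $ \<sigma> i * x $ i))) \<in> trig_polys (CARD('n) - 1)"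
    for \<sigma> :: "'n \<Rightarrow> 'n"
    using trig_polys_mult[OF trig_polys_const[of _ 0]] by fastforce
  then show ?thesis unfolding cos_minus_def[abs_def] by (intro trig_polys_sum)
qed

lemma trig_polys_peval_phi:
  fixes f :: "'n::{finite,wellorder} rpoly"
  shows "(\<lambda>x. peval f (phi x)) \<in> trig_polys (total_degree f)"
  unfolding peval_def
proof (rule trig_polys_sum)
  fix m assume m: "m \<in> Poly_Mapping.keys f"
  have "(\<lambda>x :: real^'n::_. Poly_Mapping.lookup f m * (\<Prod>i\<in>UNIV. (phi x $ i) ^ Poly_Mapping.lookup m i))
      \<in> trig_polys (0 + (\<Sum>i\<in>UNIV. Poly_Mapping.lookup m i * 1))"
    by (intro trig_polys_mult trig_polys_const trig_polys_prod trig_polys_power trig_polys_phi)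
  moreover have "0 + (\<Sum>i\<in>UNIV. Poly_Mapping.lookup m i * 1) \<le> total_degree f"
    unfolding total_degree_def using m by (intro Max_ge) auto
  ultimately show "(\<lambda>x :: real^'n::_. Poly_Mapping.lookup f m * (\<Prod>i\<in>UNIV. (phi x $ i) ^ Poly_Mapping.lookup m i))
      \<in> trig_polys (total_degree f)"
    using trig_polys_mono by blast
qed

text \<open>Lebesgue measure on a Euclidean space is the image of the product measure on its coordinates, so
  the integral of a product of one-variable functions factors.\<close>

lemma lborel_integral_prod:
  fixes f :: "'a::euclidean_space \<Rightarrow> real \<Rightarrow> real"
  assumes "\<And>b. b \<in> Basis \<Longrightarrow> integrable lborel (f b)"
  shows "(\<integral>x. (\<Prod>b\<in>Basis. f b (x \<bullet> b)) \<partial>lborel) = (\<Prod>b\<in>Basis. \<integral>t. f b t \<partial>lborel)"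
proof -
  interpret product_sigma_finite "\<lambda>_ :: 'a. lborel :: real measure" by standard
  have [measurable]: "f b \<in> borel_measurable borel" if "b \<in> Basis" for b
    using borel_measurable_integrable[OF assms[OF that]] by simp
  have "(\<integral>x. (\<Prod>b\<in>Basis. f b (x \<bullet> b)) \<partial>lborel) =
      (\<integral>y. (\<Prod>b\<in>Basis. f b ((\<Sum>b\<in>Basis. y b *\<^sub>R b) \<bullet> b)) \<partial>(\<Pi>\<^sub>M b\<in>Basis. lborel))"
    by (subst lborel_eq, rule integral_distr) measurable
  also have "\<dots> = (\<integral>y. (\<Prod>b\<in>Basis. f b (y b)) \<partial>(\<Pi>\<^sub>M b\<in>Basis. lborel))"
    by simp
  also have "\<dots> = (\<Prod>b\<in>Basis. \<integral>t. f b t \<partial>lborel)"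
    using assms by (rule product_integral_prod[OF finite_Basis])
  finally show ?thesis .
qed

lemma integral_unit_cube_prod:
  fixes g :: "'n::finite \<Rightarrow> real \<Rightarrow> real"
  assumes cont: "\<And>i. continuous_on UNIV (g i)"
  shows "integral (cbox 0 1) (\<lambda>x :: real^'n. \<Prod>i\<in>UNIV. g i (x $ i)) = (\<Prod>i\<in>UNIV. integral {0..1} (g i))"
proof -
  let ?h = "\<lambda>x :: real^'n. \<Prod>i\<in>UNIV. g i (x $ i)"
  let ?G = "\<lambda>i t. indicator {0..1} t *\<^sub>R g i t"
  have G: "integrable lborel (?G i)" "(\<integral>t. ?G i t \<partial>lborel) = integral {0..1} (g i)" for i
  proof -
    show int: "integrable lborel (?G i)"
      by (rule borel_integrable_compact) (auto intro: continuous_on_subset[OF cont])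
    then show "(\<integral>t. ?G i t \<partial>lborel) = integral {0..1} (g i)"
      using set_borel_integral_eq_integral(2)[of "{0..1}" "g i"]
      by (simp add: set_integrable_def set_lebesgue_integral_def)
  qed
  have Basis: "bij_betw (\<lambda>i. axis i 1) UNIV (Basis :: (real^'n) set)"
    by (auto simp: bij_betw_def inj_on_def axis_eq_axis Basis_vec_def)
  have "continuous_on (cbox 0 1) ?h"
  proof (rule continuous_on_prod)
    show "continuous_on (cbox 0 1) (\<lambda>x :: real^'n. g i (x $ i))" for i
      by (rule continuous_on_compose2[OF cont]) (auto intro!: continuous_intros)
  qed
  then have "set_integrable lborel (cbox 0 1) ?h"
    unfolding set_integrable_def by (intro borel_integrable_compact) auto
  then have "integral (cbox 0 1) ?h = (\<integral>x. indicator (cbox 0 1) x *\<^sub>R ?h x \<partial>lborel)"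
    using set_borel_integral_eq_integral(2)[of "cbox 0 1" ?h] by (simp add: set_lebesgue_integral_def)
  also have "\<dots> = (\<integral>x. (\<Prod>b\<in>Basis. ?G (axis_index b) ((x :: real^'n) \<bullet> b)) \<partial>lborel)"
  proof (rule Bochner_Integration.integral_cong[OF refl])
    fix x :: "real^'n"
    have "(\<Prod>b\<in>Basis. ?G (axis_index b) (x \<bullet> b)) = (\<Prod>i\<in>UNIV. ?G i (x $ i))"
      by (subst prod.reindex_bij_betw[OF Basis, symmetric]) (simp add: inner_axis)
    also have "\<dots> = indicator (cbox 0 1) x *\<^sub>R ?h x"
      by (auto simp: prod.distrib indicator_def mem_box_cart)
    finally show "indicator (cbox 0 1) x *\<^sub>R ?h x = (\<Prod>b\<in>Basis. ?G (axis_index b) (x \<bullet> b))" by simp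
  qed
  also have "\<dots> = (\<Prod>b\<in>(Basis :: (real^'n) set). integral {0..1} (g (axis_index b)))"
    by (subst lborel_integral_prod) (simp_all only: G)
  also have "\<dots> = (\<Prod>i\<in>UNIV. integral {0..1} (g i))"
    by (subst prod.reindex_bij_betw[OF Basis, symmetric]) simp
  finally show ?thesis .
qed

section \<open>Product quadrature rules\<close>

text \<open>Exactness of the rule \<open>c * (\<Sum>r\<in>R. w r * f (s r))\<close> for the integral over \<open>[0, 1]\<close> is tested on
  the cosines of degree at most \<open>d\<close>, whose integrals are \<open>1\<close> for \<open>k = 0\<close> and \<open>0\<close> otherwise.\<close>

definition quadrature :: "'r set \<Rightarrow> ('r \<Rightarrow> real) \<Rightarrow> ('r \<Rightarrow> real) \<Rightarrow> real \<Rightarrow> nat \<Rightarrow> bool" where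
  "quadrature R w s c d \<longleftrightarrow>
     (\<forall>k\<le>d. c * (\<Sum>r\<in>R. w r * cos (pi * real k * s r)) = (if k = 0 then 1 else 0))"

lemma has_integral_cos_unit:
  "((\<lambda>t. cos (pi * real k * t)) has_integral (if k = 0 then 1 else 0)) {0..1}"
proof (cases "k = 0")
  case True
  then show ?thesis using has_integral_const_real[of "1::real" 0 1] by simp
next
  case False
  have "((\<lambda>t. cos (pi * real k * t)) has_integral sin (pi * real k * 1) / (pi * real k) - sin (pi * real k * 0) / (pi * real k)) {0..1}"
    by (rule fundamental_theorem_of_calculus)
       (use False in \<open>auto intro!: derivative_eq_intros simp flip: has_real_derivative_iff_has_vector_derivative\<close>)
  moreover have "sin (pi * real k) = 0" by (metis mult.commute sin_npi)
  ultimately show ?thesis using False by simp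
qed

lemma quadrature_trig_poly:
  assumes q: "quadrature R w s c d" and f: "f \<in> trig_poly d"
  shows "integral {0..1} f = c * (\<Sum>r\<in>R. w r * f (s r))"
proof -
  have "(f has_integral c * (\<Sum>r\<in>R. w r * f (s r))) {0..1}"
    using f unfolding trig_poly_def
  proof induction
    case (step g f)
    then obtain b k where g: "g = (\<lambda>t. b * cos (pi * real k * t))" "k \<le> d" by auto
    have "c * (\<Sum>r\<in>R. w r * g (s r)) = b * (if k = 0 then 1 else 0)"
    proof -
      have "c * (\<Sum>r\<in>R. w r * g (s r)) = b * (c * (\<Sum>r\<in>R. w r * cos (pi * real k * s r)))"
        by (simp add: g sum_distrib_left mult_ac)
      moreover have "c * (\<Sum>r\<in>R. w r * cos (pi * real k * s r)) = (if k = 0 then 1 else 0)"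
        using q g(2) unfolding quadrature_def by blast
      ultimately show ?thesis by (simp only:)
    qed
    then have "(g has_integral c * (\<Sum>r\<in>R. w r * g (s r))) {0..1}"
      using has_integral_mult_right[OF has_integral_cos_unit[of k], of b] by (simp add: g)
    from has_integral_add[OF this step(3)] show ?case
      by (simp add: distrib_left sum.distrib)
  qed simp
  then show ?thesis by (rule integral_unique)
qed

lemma quadrature_trig_polys:
  fixes h :: "real^'n::finite \<Rightarrow> real"
  assumes q: "quadrature R w s c d" and "finite R" and h: "h \<in> trig_polys d"
  shows "integral (cbox 0 1) h =
    c ^ CARD('n) * (\<Sum>v | \<forall>i. v $ i \<in> R. (\<Prod>i\<in>UNIV. w (v $ i)) * h (\<chi> i. s (v $ i)))"
  using h unfolding trig_polys_def
proof induction
  case (step g f)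
  from step(1) obtain u where g: "g = (\<lambda>x. \<Prod>i\<in>UNIV. u i (x $ i))" and u: "\<And>i. u i \<in> trig_poly d" by auto
  have g_int: "integral (cbox 0 1) g = c ^ CARD('n) * (\<Sum>v | \<forall>i. v $ i \<in> R. (\<Prod>i\<in>UNIV. w (v $ i)) * g (\<chi> i. s (v $ i)))"
  proof -
    have "integral (cbox 0 1) g = (\<Prod>i\<in>UNIV. integral {0..1} (u i))"
      unfolding g by (rule integral_unit_cube_prod) (rule trig_poly_continuous[OF u])
    also have "\<dots> = c ^ CARD('n) * (\<Prod>i\<in>UNIV. \<Sum>r\<in>R. w r * u i (s r))"
      by (simp add: quadrature_trig_poly[OF q u] prod.distrib)
    also have "(\<Prod>i\<in>UNIV. \<Sum>r\<in>R. w r * u i (s r)) = (\<Sum>p\<in>PiE UNIV (\<lambda>_. R). \<Prod>i\<in>UNIV. w (p i) * u i (s (p i)))"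
      by (rule prod_sum_PiE) (use \<open>finite R\<close> in auto)
    also have "\<dots> = (\<Sum>v | \<forall>i. v $ i \<in> R. \<Prod>i\<in>UNIV. w (v $ i) * u i (s (v $ i)))"
      by (rule sum.reindex_bij_witness[of _ "($)" "vec_lambda"]) auto
    finally show ?thesis by (simp add: g prod.distrib)
  qed
  have "g \<in> trig_polys d" "f \<in> trig_polys d"
    using step(1,2) unfolding trig_polys_def by (auto intro: fin_sums_base)
  then have "g integrable_on cbox 0 1" "f integrable_on cbox 0 1"
    by (auto intro!: integrable_continuous trig_polys_continuous)
  then have "integral (cbox 0 1) (\<lambda>x. g x + f x) = integral (cbox 0 1) g + integral (cbox 0 1) f"
    by (rule integral_add)
  then show ?case
    by (simp only: g_int step(3) distrib_left sum.distrib)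
qed simp

section \<open>The three families of nodes\<close>

lemma sum_cos_telescope:
  "2 * sin a * (\<Sum>r<M. cos (b + 2 * real r * a)) = sin (b + (2 * real M - 1) * a) - sin (b - a)"
proof (induction M)
  case (Suc M)
  have "2 * sin a * cos (b + 2 * real M * a) = sin (b + (2 * real M + 1) * a) - sin (b + (2 * real M - 1) * a)"
  proof -
    have "b + (2 * real M + 1) * a = (b + 2 * real M * a) + a" "b + (2 * real M - 1) * a = (b + 2 * real M * a) - a"
      by (simp_all add: algebra_simps)
    moreover have "2 * sin a * cos y = sin (y + a) - sin (y - a)" for y
      by (simp add: sin_add sin_diff)
    ultimately show ?thesis by (simp only:)
  qed
  moreover have "2 * real (Suc M) - 1 = 2 * real M + 1" by simp
  ultimately show ?case using Suc by (simp only: sum.lessThan_Suc distrib_left)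
qed (simp add: left_diff_distrib)

lemma sum_int_range: "(\<Sum>r\<in>{0..int M - 1}. f r) = (\<Sum>r<M. f (int r))"
proof -
  have "bij_betw int {..<M} {0..int M - 1}"
    by (rule bij_betwI[of _ _ _ nat]) auto
  then show ?thesis by (simp add: sum.reindex_bij_betw)
qed

text \<open>With \<open>a = pi * k / (2 * N)\<close> the sum is telescoped after multiplication by \<open>2 * sin a\<close>, and the
  half weights at both ends remove what is left over. The bound on \<open>k\<close> is exactly \<open>a < pi\<close>, which
  keeps \<open>sin a\<close> away from zero.\<close>

lemma quadrature_nodes_I:
  assumes "N \<ge> 1"
  shows "quadrature {0..int N} (cwt N) (\<lambda>r. of_int r / real N) (1 / real N) (2 * N - 1)"
  unfolding quadrature_def
proof (intro allI impI)
  fix k assume k: "k \<le> 2 * N - 1"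
  define a where "a = pi * real k / (2 * real N)"
  let ?C = "\<lambda>r. cos (2 * real r * a)"
  have "(\<Sum>r\<in>{0..int N}. cwt N r * cos (pi * real k * (of_int r / real N))) = (\<Sum>r<Suc N. cwt N (int r) * ?C r)"
  proof -
    have range: "{0..int N} = {0..int (Suc N) - 1}" by simp
    show ?thesis unfolding range sum_int_range
      by (intro sum.cong refl) (use assms in \<open>simp add: a_def mult_ac\<close>)
  qed
  also have "\<dots> = (\<Sum>r<Suc N. ?C r - (if r = 0 then 1 / 2 else 0) - (if r = N then ?C N / 2 else 0))"
    using assms by (intro sum.cong refl) (auto simp: cwt_def)
  also have "\<dots> = (\<Sum>r<Suc N. ?C r) - 1 / 2 - ?C N / 2"
    unfolding sum_subtractf by (simp only: sum.delta finite_lessThan) simp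
  finally have sum: "(\<Sum>r\<in>{0..int N}. cwt N r * cos (pi * real k * (of_int r / real N))) = (\<Sum>r<Suc N. ?C r) - 1 / 2 - ?C N / 2" .
  show "1 / real N * (\<Sum>r\<in>{0..int N}. cwt N r * cos (pi * real k * (of_int r / real N))) = (if k = 0 then 1 else 0)"
  proof (cases "k = 0")
    case True
    then show ?thesis unfolding sum using assms by (simp add: a_def)
  next
    case False
    have "0 < a" "a < pi" using False assms k by (auto simp: a_def field_simps)
    then have "sin a \<noteq> 0" using sin_gt_zero[of a] by simp
    have "2 * real N * a = real k * pi" using assms by (simp add: a_def)
    then have "sin (2 * real N * a) = 0" by (simp add: sin_npi)
    moreover have "(2 * real N + 1) * a = 2 * real N * a + a" by (simp only: distrib_right mult_1_left)
    ultimately have "sin ((2 * real N + 1) * a) = cos (2 * real N * a) * sin a"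
      by (simp only: sin_add mult_zero_left add_0_left)
    then have "2 * sin a * ((\<Sum>r<Suc N. ?C r) - 1 / 2 - ?C N / 2) = 0"
    proof -
      assume s: "sin ((2 * real N + 1) * a) = cos (2 * real N * a) * sin a"
      have "2 * sin a * (\<Sum>r<Suc N. ?C r) = sin ((2 * real N + 1) * a) + sin a"
      proof -
        have "2 * real (Suc N) - 1 = 2 * real N + 1" by simp
        then show ?thesis
          using sum_cos_telescope[of a 0 "Suc N"]
          by (simp only: add_0_left diff_0 sin_minus diff_minus_eq_add)
      qed
      then show ?thesis unfolding right_diff_distrib s by simp
    qed
    then show ?thesis using \<open>sin a \<noteq> 0\<close> False unfolding sum by simp
  qed
qed

text \<open>The same telescoping with \<open>a = pi * k / (2 * N - 1)\<close>. The index \<open>N\<close> is out of range, so only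
  \<open>r = 0\<close> has the weight one half.\<close>

lemma quadrature_nodes_V:
  assumes "N \<ge> 1"
  shows "quadrature {0..int N - 1} (cwt N) (\<lambda>r. 2 * of_int r / (2 * real N - 1)) (2 / (2 * real N - 1)) (2 * N - 2)"
  unfolding quadrature_def
proof (intro allI impI)
  fix k assume k: "k \<le> 2 * N - 2"
  have N: "2 * real N - 1 > 0" using assms by simp
  define a where "a = pi * real k / (2 * real N - 1)"
  let ?C = "\<lambda>r. cos (2 * real r * a)"
  have "(\<Sum>r\<in>{0..int N - 1}. cwt N r * cos (pi * real k * (2 * of_int r / (2 * real N - 1)))) = (\<Sum>r<N. cwt N (int r) * ?C r)"
    unfolding sum_int_range by (simp add: a_def mult_ac)
  also have "\<dots> = (\<Sum>r<N. ?C r - (if r = 0 then 1 / 2 else 0))"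
    by (intro sum.cong refl) (auto simp: cwt_def)
  also have "\<dots> = (\<Sum>r<N. ?C r) - 1 / 2"
    using assms by (simp add: sum_subtractf)
  finally have sum: "(\<Sum>r\<in>{0..int N - 1}. cwt N r * cos (pi * real k * (2 * of_int r / (2 * real N - 1)))) = (\<Sum>r<N. ?C r) - 1 / 2" .
  show "2 / (2 * real N - 1) * (\<Sum>r\<in>{0..int N - 1}. cwt N r * cos (pi * real k * (2 * of_int r / (2 * real N - 1)))) = (if k = 0 then 1 else 0)"
  proof (cases "k = 0")
    case True
    then show ?thesis unfolding sum using N by (simp add: a_def field_simps)
  next
    case False
    have "real k < 2 * real N - 1" using k assms by linarith
    then have "pi * real k < pi * (2 * real N - 1)" by simp
    then have "0 < a" "a < pi" using False N by (simp_all add: a_def divide_less_eq)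
    then have "sin a \<noteq> 0" using sin_gt_zero[of a] by simp
    have "(2 * real N - 1) * a = real k * pi" using N by (simp add: a_def)
    then have "sin ((2 * real N - 1) * a) = 0" by (simp add: sin_npi)
    then have "2 * sin a * ((\<Sum>r<N. ?C r) - 1 / 2) = 0"
    proof -
      assume s: "sin ((2 * real N - 1) * a) = 0"
      have "2 * sin a * (\<Sum>r<N. ?C r) = sin ((2 * real N - 1) * a) + sin a"
        using sum_cos_telescope[of a 0 N] by (simp only: add_0_left diff_0 sin_minus diff_minus_eq_add)
      then show ?thesis unfolding right_diff_distrib s by simp
    qed
    then show ?thesis using \<open>sin a \<noteq> 0\<close> False unfolding sum by simp
  qed
qed

text \<open>The same telescoping, started at angle \<open>a\<close>. The shift of the weight by one puts the half weight
  on the last node \<open>r = N - 1\<close>, which is the end point \<open>1\<close>.\<close>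

lemma quadrature_nodes_VI:
  assumes "N \<ge> 1"
  shows "quadrature {0..int N - 1} (\<lambda>r. cwt N (r + 1)) (\<lambda>r. 2 * (of_int r + 1 / 2) / (2 * real N - 1))
    (2 / (2 * real N - 1)) (2 * N - 2)"
  unfolding quadrature_def
proof (intro allI impI)
  fix k assume k: "k \<le> 2 * N - 2"
  have N: "2 * real N - 1 > 0" using assms by simp
  define a where "a = pi * real k / (2 * real N - 1)"
  let ?C = "\<lambda>r. cos (a + 2 * real r * a)"
  have "pi * real k * (2 * (of_int (int r) + 1 / 2) / (2 * real N - 1)) = a + 2 * real r * a" for r
    by (simp add: a_def add_divide_distrib[symmetric]) (simp add: algebra_simps)
  then have "(\<Sum>r\<in>{0..int N - 1}. cwt N (r + 1) * cos (pi * real k * (2 * (of_int r + 1 / 2) / (2 * real N - 1)))) = (\<Sum>r<N. cwt N (int r + 1) * ?C r)"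
    unfolding sum_int_range by simp
  also have "\<dots> = (\<Sum>r<N. ?C r - (if r = N - 1 then ?C (N - 1) / 2 else 0))"
    by (intro sum.cong refl) (auto simp: cwt_def)
  also have "\<dots> = (\<Sum>r<N. ?C r) - ?C (N - 1) / 2"
    using assms by (simp add: sum_subtractf)
  also have "?C (N - 1) = cos ((2 * real N - 1) * a)"
    using assms by (simp add: of_nat_diff algebra_simps)
  finally have sum: "(\<Sum>r\<in>{0..int N - 1}. cwt N (r + 1) * cos (pi * real k * (2 * (of_int r + 1 / 2) / (2 * real N - 1)))) = (\<Sum>r<N. ?C r) - cos ((2 * real N - 1) * a) / 2" .
  show "2 / (2 * real N - 1) * (\<Sum>r\<in>{0..int N - 1}. cwt N (r + 1) * cos (pi * real k * (2 * (of_int r + 1 / 2) / (2 * real N - 1)))) = (if k = 0 then 1 else 0)"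
  proof (cases "k = 0")
    case True
    then show ?thesis unfolding sum using N by (simp add: a_def field_simps)
  next
    case False
    have "real k < 2 * real N - 1" using k assms by linarith
    then have "pi * real k < pi * (2 * real N - 1)" by simp
    then have "0 < a" "a < pi" using False N by (simp_all add: a_def divide_less_eq)
    then have "sin a \<noteq> 0" using sin_gt_zero[of a] by simp
    have "(2 * real N - 1) * a = real k * pi" using N by (simp add: a_def)
    then have "sin ((2 * real N - 1) * a) = 0" by (simp add: sin_npi)
    then have "sin (a + (2 * real N - 1) * a) = sin a * cos ((2 * real N - 1) * a)"
      by (simp only: sin_add mult_zero_right add_0_right)
    then have "2 * sin a * ((\<Sum>r<N. ?C r) - cos ((2 * real N - 1) * a) / 2) = 0"
    proof -
      assume s: "sin (a + (2 * real N - 1) * a) = sin a * cos ((2 * real N - 1) * a)"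
      have "2 * sin a * (\<Sum>r<N. ?C r) = sin (a + (2 * real N - 1) * a)"
        using sum_cos_telescope[of a a N] by (simp only: diff_self sin_zero diff_0_right)
      then show ?thesis unfolding right_diff_distrib s by simp
    qed
    then show ?thesis using \<open>sin a \<noteq> 0\<close> False unfolding sum by simp
  qed
qed

section \<open>The cubature formulas\<close>

lemma phi_permute_coords:
  fixes x :: "real^'n::{finite,wellorder}"
  assumes "\<sigma> permutes UNIV"
  shows "phi (permute_coords \<sigma> x) = phi x"
proof -
  have "cos_plus l (permute_coords \<sigma> x) = cos_plus l x" for l
  proof -
    have "cos_plus l (permute_coords \<sigma> x) =
        (\<Sum>\<tau> | \<tau> permutes UNIV. \<Prod>i\<in>UNIV. cos (pi * l $ (\<tau> \<circ> \<sigma>) i * x $ \<sigma> i))"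
      unfolding cos_plus_def by (subst sum_permutations_compose_right[OF assms]) (simp add: permute_coords_def)
    also have "\<dots> = cos_plus l x"
      unfolding cos_plus_def
      by (intro sum.cong refl) (subst prod.permute[OF assms], simp add: comp_def)
    finally show ?thesis .
  qed
  then show ?thesis by (simp add: phi_def Xvar_def)
qed

lemma cos_minus_permute_coords:
  fixes x :: "real^'n::finite"
  assumes "\<sigma> permutes UNIV"
  shows "cos_minus l (permute_coords \<sigma> x) = of_int (sign \<sigma>) * cos_minus l x"
proof -
  have perm: "permutation \<tau>" if "\<tau> permutes (UNIV :: 'n set)" for \<tau>
    using that by (auto simp: permutation_permutes)
  have "cos_minus l (permute_coords \<sigma> x) =
      (\<Sum>\<tau> | \<tau> permutes UNIV. of_int (sign (\<tau> \<circ> \<sigma>)) * (\<Prod>i\<in>UNIV. cos (pi * l $ (\<tau> \<circ> \<sigma>) i * x $ \<sigma> i)))"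
    unfolding cos_minus_def by (subst sum_permutations_compose_right[OF assms]) (simp add: permute_coords_def)
  also have "\<dots> = (\<Sum>\<tau> | \<tau> permutes UNIV. of_int (sign \<sigma>) * (of_int (sign \<tau>) * (\<Prod>i\<in>UNIV. cos (pi * l $ \<tau> i * x $ i))))"
  proof (intro sum.cong refl)
    fix \<tau> :: "'n \<Rightarrow> 'n" assume "\<tau> \<in> {\<tau>. \<tau> permutes UNIV}"
    then have "sign (\<tau> \<circ> \<sigma>) = sign \<tau> * sign \<sigma>" by (intro sign_compose perm assms) simp
    moreover have "(\<Prod>i\<in>UNIV. cos (pi * l $ (\<tau> \<circ> \<sigma>) i * x $ \<sigma> i)) = (\<Prod>i\<in>UNIV. cos (pi * l $ \<tau> i * x $ i))"
      by (subst (2) prod.permute[OF assms]) (simp add: comp_def)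
    ultimately show "of_int (sign (\<tau> \<circ> \<sigma>)) * (\<Prod>i\<in>UNIV. cos (pi * l $ (\<tau> \<circ> \<sigma>) i * x $ \<sigma> i))
      = of_int (sign \<sigma>) * (of_int (sign \<tau>) * (\<Prod>i\<in>UNIV. cos (pi * l $ \<tau> i * x $ i)))"
      by (simp add: mult_ac)
  qed
  finally show ?thesis by (simp add: cos_minus_def sum_distrib_left)
qed

lemma cos_minus_eq_0:
  fixes x :: "real^'n::finite"
  assumes "\<not> inj (($) x)"
  shows "cos_minus l x = 0"
proof -
  obtain i j where ij: "x $ i = x $ j" "i \<noteq> j" using assms by (auto simp: inj_def)
  let ?\<tau> = "Transposition.transpose i j"
  have "permute_coords ?\<tau> x = x"
    using ij by (auto simp: permute_coords_def vec_eq_iff Transposition.transpose_def)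
  then show ?thesis
    using cos_minus_permute_coords[of ?\<tau> l x] ij(2) by (simp add: permutes_swap_id sign_swap_id)
qed

lemma negligible_Jdet_zero: "negligible {x \<in> Fdom. Jdet (x :: real^'n::{finite,wellorder}) = 0}"
proof -
  let ?B = "(\<Union>i. {x :: real^'n::_. x $ i = 0}) \<union> (\<Union>i. {x. x $ i = 1}) \<union> {x. \<not> inj (($) x)}"
  have hyper: "negligible (\<Union>i. {x :: real^'n::_. x $ i = t})" for t
    by (rule negligible_Union, simp, erule imageE, simp only: negligible_coord_eq_const)
  have "x \<in> ?B" if x: "x \<in> Fdom" "Jdet x = 0" for x
  proof (rule ccontr)
    assume nB: "x \<notin> ?B"
    have range: "0 < x $ i" "x $ i < 1" for i
      using x(1) nB by (auto simp: Fdom_def less_le)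
    have "sin (pi * x $ i) \<noteq> 0" for i
      using sin_gt_zero[of "pi * x $ i"] range[of i] by simp
    moreover have pi_range: "0 \<le> pi * x $ i" "pi * x $ i \<le> pi" for i
      using range[of i] by (simp_all add: mult_le_cancel_left1)
    have "cos (pi * x $ i) \<noteq> cos (pi * x $ j)" if "i \<noteq> j" for i j
    proof
      assume "cos (pi * x $ i) = cos (pi * x $ j)"
      then have "pi * x $ i = pi * x $ j"
        using cos_inj_pi[OF pi_range pi_range] by blast
      then show False using that nB by (auto simp: inj_def)
    qed
    ultimately show False using Jdet_nonzero[of x] x(2) by blast
  qed
  then have "{x \<in> Fdom. Jdet x = 0} \<subseteq> ?B" by blast
  moreover have "negligible ?B"
    using negligible_Un[OF negligible_Un[OF hyper[of 0] hyper[of 1]] negligible_noninjective] by blast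
  ultimately show ?thesis by (rule negligible_subset[rotated])
qed

text \<open>For \<open>x\<close> in \<open>Fdom\<close> with nonzero Jacobian, \<open>JJ (phi x) = \<bar>Jdet x\<bar>\<close> cancels against the factor of the
  change of variables. The remaining points, where the quotient defining the weight takes the value
  \<open>0\<close>, are a null set.\<close>

lemma has_integral_omega:
  fixes f :: "'n::{finite,wellorder} rpoly"
  defines "h \<equiv> \<lambda>x. peval f (phi x) * (cos_minus rho1 x)\<^sup>2"
  assumes h: "h absolutely_integrable_on Fdom"
  shows "((\<lambda>Y. peval f Y * omega_I_minus Y) has_integral integral Fdom h) FF"
proof -
  define D where "D x = frechet_derivative phi (at x)" for x :: "real^'n::_"
  define u where "u x = \<bar>det (matrix (D x))\<bar> * (peval f (phi x) * omega_I_minus (phi x))" for x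
  have u: "u x = h x" if "x \<in> Fdom - {x \<in> Fdom. Jdet x = 0}" for x
  proof -
    have x: "Jdet x \<noteq> 0" "x \<in> Fdom" using that by blast+
    have "omega_I_minus (phi x) = (cos_minus rho1 x)\<^sup>2 / \<bar>Jdet x\<bar>"
      unfolding omega_I_minus_def JJ_def peval_p_I_plus[OF x(2)] peval_J_I_minus[OF x(2)]
      by (simp only: real_sqrt_abs)
    moreover have "det (matrix (D x)) = Jdet x" unfolding Jdet_def jacobian_def D_def ..
    ultimately show ?thesis using x(1) by (simp add: u_def h_def)
  qed
  have int: "u absolutely_integrable_on Fdom"
    by (rule absolutely_integrable_spike[OF h negligible_Jdet_zero u])
  have eq: "integral Fdom u = integral Fdom h"
    by (rule integral_spike[OF negligible_Jdet_zero]) (rule u[symmetric])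
  have "(phi has_derivative D x) (at x)" for x
    unfolding D_def using phi_differentiable[of x] by (simp only: frechet_derivative_works)
  then have der: "(phi has_derivative D x) (at x within Fdom)" for x
    by (rule has_derivative_at_withinI)
  from has_integral_image[OF Fdom_lebesgue der inj_on_phi int[unfolded u_def]] eq show ?thesis
    unfolding FF_def u_def by (simp only:)
qed

text \<open>The degree condition leaves room for \<open>(cos_minus rho1)\<^sup>2\<close>, of degree \<open>2 * (n - 1)\<close> in each
  coordinate. Strict monotonicity of the nodes makes a strictly decreasing label a point of \<open>Fdom\<close>.\<close>

lemma cubature_strict_cone:
  fixes f :: "'n::{finite,wellorder} rpoly" and R :: "'r::linorder set" and s :: "'r \<Rightarrow> real"
  defines "pt \<equiv> \<lambda>v. (\<chi> i. s (v $ i)) :: real^'n::_"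
  assumes R: "finite R" and q: "quadrature R w s c d"
    and d: "total_degree f + 2 * (CARD('n) - 1) \<le> d"
    and s: "strict_mono_on R s" and s01: "s ` R \<subseteq> {0..1}"
  shows "((\<lambda>Y. peval f Y * omega_I_minus Y) has_integral
     c ^ CARD('n) * (\<Sum>v\<in>strict_cone R. (\<Prod>i\<in>UNIV. w (v $ i)) * peval f (phi (pt v)) * peval J_I_minus (phi (pt v)))) FF"
    and "pt ` strict_cone R \<subseteq> Fdom" and "inj_on pt (strict_cone R)"
proof -
  show Fdom: "pt ` strict_cone R \<subseteq> Fdom"
  proof
    fix x assume "x \<in> pt ` strict_cone R"
    then obtain v where v: "v \<in> strict_cone R" "x = pt v" by auto
    have vR: "v $ i \<in> R" for i using v(1) by (simp add: strict_cone_def)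
    have "s (v $ j) \<le> s (v $ i)" if "i \<le> j" for i j
    proof (cases "i = j")
      case False
      then have "v $ j < v $ i" using v(1) that by (simp add: strict_cone_def)
      from strict_mono_onD[OF s vR vR this] show ?thesis by simp
    qed simp
    moreover have "s (v $ i) \<in> {0..1}" for i using s01 vR by blast
    ultimately show "x \<in> Fdom" by (simp add: Fdom_def v(2) pt_def)
  qed
  have s_inj: "inj_on s R" by (rule strict_mono_on_imp_inj_on[OF s])
  show "inj_on pt (strict_cone R)"
  proof (rule inj_onI)
    fix v v' assume "v \<in> strict_cone R" "v' \<in> strict_cone R" "pt v = pt v'"
    then have "v $ i \<in> R" "v' $ i \<in> R" "s (v $ i) = s (v' $ i)" for i
      by (simp_all add: strict_cone_def pt_def vec_eq_iff)
    then show "v = v'" unfolding vec_eq_iff using inj_onD[OF s_inj] by blast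
  qed
  define h where "h x = peval f (phi x) * (cos_minus rho1 x)\<^sup>2" for x :: "real^'n::_"
  have "h \<in> trig_polys (total_degree f + 2 * (CARD('n) - 1))"
    unfolding h_def by (intro trig_polys_mult trig_polys_peval_phi trig_polys_power trig_polys_cos_minus)
  then have h: "h \<in> trig_polys d" using trig_polys_mono[OF d] by blast
  have h_sym: "h (permute_coords \<sigma> x) = h x" if "\<sigma> permutes UNIV" for \<sigma> x
  proof -
    have "(of_int (sign \<sigma>))\<^sup>2 = (1 :: real)" by (simp add: sign_def)
    then show ?thesis
      by (simp add: h_def phi_permute_coords[OF that] cos_minus_permute_coords[OF that] power_mult_distrib)
  qed
  note int = integral_symmetric[OF trig_polys_continuous[OF h] h_sym]
  define g where "g v = (\<Prod>i\<in>UNIV. w (v $ i)) * h (pt v)" for v :: "'r^'n::_"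
  have "(\<Sum>v | \<forall>i. v $ i \<in> R. g v) = fact CARD('n) * (\<Sum>v\<in>strict_cone R. g v)"
  proof (rule sum_symmetric[OF R])
    fix \<sigma> :: "'n \<Rightarrow> 'n" and v :: "'r^'n::_"
    assume \<sigma>: "\<sigma> permutes UNIV"
    have "pt (permute_coords \<sigma> v) = permute_coords \<sigma> (pt v)" by (simp add: pt_def permute_coords_def)
    moreover have "(\<Prod>i\<in>UNIV. w (permute_coords \<sigma> v $ i)) = (\<Prod>i\<in>UNIV. w (v $ i))"
      by (subst (2) prod.permute[OF \<sigma>]) (simp add: permute_coords_def)
    ultimately show "g (permute_coords \<sigma> v) = g v" by (simp add: g_def h_sym[OF \<sigma>])
  next
    fix v :: "'r^'n::_" assume "\<not> inj (($) v)"
    then obtain i j where "v $ i = v $ j" "i \<noteq> j" by (auto simp: inj_def)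
    then have "pt v $ i = pt v $ j" "i \<noteq> j" by (simp_all add: pt_def)
    then have "\<not> inj (($) (pt v))" by (metis injD)
    then show "g v = 0" by (simp add: g_def h_def cos_minus_eq_0)
  qed
  moreover have "integral (cbox 0 1) h = c ^ CARD('n) * (\<Sum>v | \<forall>i. v $ i \<in> R. g v)"
    unfolding g_def pt_def by (rule quadrature_trig_polys[OF q R h])
  ultimately have "integral Fdom h = c ^ CARD('n) * (\<Sum>v\<in>strict_cone R. g v)"
    using int(2) by simp
  moreover have "g v = (\<Prod>i\<in>UNIV. w (v $ i)) * peval f (phi (pt v)) * peval J_I_minus (phi (pt v))"
    if "v \<in> strict_cone R" for v
  proof -
    have "pt v \<in> Fdom" using Fdom that by blast
    then show ?thesis by (simp add: g_def h_def peval_J_I_minus)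
  qed
  ultimately have "integral Fdom h =
      c ^ CARD('n) * (\<Sum>v\<in>strict_cone R. (\<Prod>i\<in>UNIV. w (v $ i)) * peval f (phi (pt v)) * peval J_I_minus (phi (pt v)))"
    by simp
  then show "((\<lambda>Y. peval f Y * omega_I_minus Y) has_integral
     c ^ CARD('n) * (\<Sum>v\<in>strict_cone R. (\<Prod>i\<in>UNIV. w (v $ i)) * peval f (phi (pt v)) * peval J_I_minus (phi (pt v)))) FF"
    using has_integral_omega[of f] int(1) unfolding h_def by simp
qed

lemma D_minus_strict_cone: "D_minus M = strict_cone {0..int M - 1}"
  by (auto simp: D_minus_def strict_cone_def)

text \<open>Summation over the image points agrees with summation over the labels because \<open>phi\<close> composed with
  the node map is injective; for the same reason \<open>node_label\<close> recovers the label.\<close>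

lemma cubature_node_labels:
  fixes f :: "'n::{finite,wellorder} rpoly" and pt :: "int^'n::_ \<Rightarrow> real^'n::_"
  assumes pt: "pt = (\<lambda>v. \<chi> i. s (v $ i))"
    and q: "quadrature {0..int M - 1} w s c d"
    and d: "total_degree f + 2 * (CARD('n) - 1) \<le> d"
    and s: "strict_mono_on {0..int M - 1} s" and s01: "s ` {0..int M - 1} \<subseteq> {0..1}"
  shows "((\<lambda>Y. peval f Y * omega_I_minus Y) has_integral
     c ^ CARD('n) * (\<Sum>Y\<in>phi ` pt ` D_minus M.
       (\<Prod>i\<in>UNIV. w (node_label (D_minus M) pt Y $ i)) * peval f Y * peval J_I_minus Y)) FF"
proof -
  note cub = cubature_strict_cone[OF finite_atLeastAtMost_int q d s s01, folded pt D_minus_strict_cone]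
  have inj: "inj_on (\<lambda>v. phi (pt v)) (D_minus M)"
    using comp_inj_on[OF cub(3) inj_on_subset[OF inj_on_phi cub(2)]] by (simp add: comp_def)
  have label: "node_label (D_minus M) pt (phi (pt v)) = v" if "v \<in> D_minus M" for v
    unfolding node_label_def using that inj by (auto intro!: the_equality dest: inj_onD)
  have "(\<Sum>Y\<in>phi ` pt ` D_minus M. (\<Prod>i\<in>UNIV. w (node_label (D_minus M) pt Y $ i)) * peval f Y * peval J_I_minus Y)
      = (\<Sum>v\<in>D_minus M. (\<Prod>i\<in>UNIV. w (v $ i)) * peval f (phi (pt v)) * peval J_I_minus (phi (pt v)))"
    unfolding image_image by (subst sum.reindex[OF inj]) (simp add: label)
  then show ?thesis using cub(1) by (simp add: pt)
qed

theorem mainTheorem13: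
  shows "(\<forall>N (f :: 'n::{finite,wellorder} rpoly).
            N \<ge> CARD('n) \<and> total_degree f \<le> 2 * (N - CARD('n)) + 1 \<longrightarrow>
            ((\<lambda>Y. peval f Y * omega_I_minus Y) has_integral
               (1 / real N) ^ CARD('n) *
               (\<Sum>Y\<in>FF_I_minus N. E_I N Y * peval f Y * peval J_I_minus Y)) FF) \<and>
         (\<forall>N (f :: 'n rpoly).
            N > CARD('n) \<and> total_degree f \<le> 2 * (N - CARD('n)) \<longrightarrow>
            ((\<lambda>Y. peval f Y * omega_I_minus Y) has_integral
               (2 / (2 * real N - 1)) ^ CARD('n) *
               (\<Sum>Y\<in>FF_V_minus N. E_V N Y * peval f Y * peval J_I_minus Y)) FF \<and>
            ((\<lambda>Y. peval f Y * omega_I_minus Y) has_integral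
               (2 / (2 * real N - 1)) ^ CARD('n) *
               (\<Sum>Y\<in>FF_VI_minus N. E_VI N Y * peval f Y * peval J_I_minus Y)) FF)"
proof (intro conjI allI impI; elim conjE)
  fix N and f :: "'n rpoly"
  assume N: "N \<ge> CARD('n)" and deg: "total_degree f \<le> 2 * (N - CARD('n)) + 1"
  have n: "CARD('n) \<ge> 1" using zero_less_card_finite[where 'a='n] by linarith
  show "((\<lambda>Y. peval f Y * omega_I_minus Y) has_integral
       (1 / real N) ^ CARD('n) * (\<Sum>Y\<in>FF_I_minus N. E_I N Y * peval f Y * peval J_I_minus Y)) FF"
    unfolding FF_I_minus_def F_I_minus_def E_I_def
  proof (rule cubature_node_labels)
    show "pt_I N = (\<lambda>v :: int^'n::_. \<chi> i. of_int (v $ i) / real N)" by (simp add: pt_I_def fun_eq_iff)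
    show "quadrature {0..int (N + 1) - 1} (cwt N) (\<lambda>r. of_int r / real N) (1 / real N) (2 * N - 1)"
      using quadrature_nodes_I[of N] N n by simp
    show "total_degree f + 2 * (CARD('n) - 1) \<le> 2 * N - 1" using N n deg by linarith
    show "strict_mono_on {0..int (N + 1) - 1} (\<lambda>r. of_int r / real N)"
      using N n by (auto intro!: strict_mono_onI divide_strict_right_mono)
    show "(\<lambda>r. of_int r / real N) ` {0..int (N + 1) - 1} \<subseteq> {0..1}"
      using N n by (auto simp: divide_le_eq)
  qed
next
  fix N and f :: "'n rpoly"
  assume N: "N > CARD('n)" and deg: "total_degree f \<le> 2 * (N - CARD('n))"
  have n: "CARD('n) \<ge> 1" using zero_less_card_finite[where 'a='n] by linarith
  have deg': "total_degree f + 2 * (CARD('n) - 1) \<le> 2 * N - 2" using N n deg by linarith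
  have N': "2 * real N - 1 > 0" using N by simp
  show "((\<lambda>Y. peval f Y * omega_I_minus Y) has_integral
       (2 / (2 * real N - 1)) ^ CARD('n) * (\<Sum>Y\<in>FF_V_minus N. E_V N Y * peval f Y * peval J_I_minus Y)) FF"
    unfolding FF_V_minus_def F_V_minus_def E_V_def
  proof (rule cubature_node_labels[OF _ _ deg'])
    show "pt_V N = (\<lambda>v :: int^'n::_. \<chi> i. 2 * of_int (v $ i) / (2 * real N - 1))" by (simp add: pt_V_def fun_eq_iff)
    show "quadrature {0..int N - 1} (cwt N) (\<lambda>r. 2 * of_int r / (2 * real N - 1)) (2 / (2 * real N - 1)) (2 * N - 2)"
      using quadrature_nodes_V[of N] N by simp
    show "strict_mono_on {0..int N - 1} (\<lambda>r. 2 * of_int r / (2 * real N - 1))"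
      using N' by (auto intro!: strict_mono_onI divide_strict_right_mono)
    show "(\<lambda>r. 2 * of_int r / (2 * real N - 1)) ` {0..int N - 1} \<subseteq> {0..1}"
      using N' by (auto simp: divide_le_eq)
  qed
  show "((\<lambda>Y. peval f Y * omega_I_minus Y) has_integral
       (2 / (2 * real N - 1)) ^ CARD('n) * (\<Sum>Y\<in>FF_VI_minus N. E_VI N Y * peval f Y * peval J_I_minus Y)) FF"
    unfolding FF_VI_minus_def F_VI_minus_def E_VI_def
  proof (rule cubature_node_labels[OF _ _ deg'])
    show "pt_VI N = (\<lambda>v :: int^'n::_. \<chi> i. 2 * (of_int (v $ i) + 1 / 2) / (2 * real N - 1))"
      by (simp add: pt_VI_def fun_eq_iff)
    show "quadrature {0..int N - 1} (\<lambda>r. cwt N (r + 1)) (\<lambda>r. 2 * (of_int r + 1 / 2) / (2 * real N - 1))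
        (2 / (2 * real N - 1)) (2 * N - 2)"
      using quadrature_nodes_VI[of N] N by simp
    show "strict_mono_on {0..int N - 1} (\<lambda>r. 2 * (of_int r + 1 / 2) / (2 * real N - 1))"
      using N' by (auto intro!: strict_mono_onI divide_strict_right_mono)
    show "(\<lambda>r. 2 * (of_int r + 1 / 2) / (2 * real N - 1)) ` {0..int N - 1} \<subseteq> {0..1}"
      using N' by (auto simp: divide_le_eq)
  qed
qed

end
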